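(* Let $(\mathbf{G},m,\Delta)$ be the twisted bialgebra of graphs. For any finite set $X$, any $\sim\in\mathcal{E}[X]$ and any graph $G\in\mathscr{G}[X]$, put \[\delta_\sim(G)=\begin{cases}G/\sim\otimes\,G\mid\sim&\text{if }\sim\in\mathcal{E}_c[G],\\0&\text{otherwise.}\end{cases}\] This defines a contraction-extraction coproduct $\delta$ on $\mathbf{G}$, and it is compatible with the product $m$ and the coproduct $\Delta$ (in the sense of the context).
   Context: $\mathbb{K}$ is a field. A graph is a pair $G=(V(G),E(G))$ with $V(G)$ a finite set and $E(G)$ a set of (unordered) pairs of distinct elements of $V(G)$. $\mathscr{G}[X]$ is the set of graphs with vertex set $X$, and $\mathbf{G}[X]$ the $\mathbb{K}$-vector space with basis $\mathscr{G}[X]$; bijections $\sigma:X\to Y$ act by relabelling vertices, making $\mathbf{G}$ a species (functor from finite sets with bijections to vector spaces). Product: $m_{X,Y}(G\otimes H)=GH$ is the disjoint union, with unit the empty graph $1\in\mathbf{G}[\emptyset]$. Coproduct: $\Delta_{X,Y}(G)=G_{\mid X}\otimes G_{\mid Y}$ for $G\in\mathscr{G}[X\sqcup Y]$, where $G_{\mid A}$ is the induced subgraph on $A$; the counit $\varepsilon_\Delta:\mathbf{G}[\emptyset]\to\mathbb{K}$ sends the empty graph to $1$. ($(\mathbf{G},m,\Delta)$ is a twisted bialgebra, i.e. a bialgebra in the category of species with the Cauchy tensor product.) $\mathcal{E}[X]$ is the set of equivalence relations on $X$, ordered by: $\sim\leq\sim'$ iff ($x\sim'y\Rightarrow x\sim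 y$). One identifies $\mathcal{E}[X/\sim']$ with $\{\sim\in\mathcal{E}[X]:\sim\leq\sim'\}$ and $(X/\sim')/\sim$ with $X/\sim$. For a bijection $\sigma:X\to Y$, $\sim_\sigma$ is the transported equivalence and $\sigma/\sim:X/\sim\to Y/\sim_\sigma$ the induced bijection. $\sim_X\sqcup\sim_Y$ is the equivalence on $X\sqcup Y$ whose classes are those of $\sim_X$ and those of $\sim_Y$. For $G\in\mathscr{G}[X]$ and $\sim\in\mathcal{E}[X]$: $G\mid\sim\,\in\mathscr{G}[X]$ has edges $\{x,y\}\in E(G)$ with $x\sim y$; $G/\sim\,\in\mathscr{G}[X/\sim]$ has as edges the pairs $\{\mathrm{cl}_\sim(x),\mathrm{cl}_\sim(y)\}$ with $\{x,y\}\in E(G)$ and $\mathrm{cl}_\sim(x)\neq\mathrm{cl}_\sim(y)$, where $\mathrm{cl}_\sim(x)$ is the class of $x$; $\sim\in\mathcal{E}_c[G]$ means that $G_{\mid C}$ is connected for every class $C$ of $\sim$. Contraction-extraction coproduct $\delta$ on a species $\mathbf{P}$: linear maps $\delta_\sim:\mathbf{P}[X]\to\mathbf{P}[X/\sim]\otimes\mathbf{P}[X]$ for every finite $X$ and $\sim\in\mathcal{E}[X]$, with: (i) $\delta_{\sim_\sigma}\circ\mathbf{P}[\sigma]=(\mathbf{P}[\sigma/\sim]\otimes\mathbf{P}[\sigma])\circ\delta_\sim$ for bijections $\sigma:X\to Y$; (ii) if $\sim\leq\sim'$, $(\delta_\sim\otimes\mathrm{Id})\circ\delta_{\sim'}=(\mathrm{Id}\otimes\delta_{\sim'})\circ\delta_\sim$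 (on the left $\delta_\sim$ is applied to $\mathbf{P}[X/\sim']$), and if $\sim\leq\sim'$ fails, $(\mathrm{Id}\otimes\delta_{\sim'})\circ\delta_\sim=0$; (iii) there are linear maps $\epsilon_\delta[X]:\mathbf{P}[X]\to\mathbb{K}$, invariant under bijections, such that $(\mathrm{Id}\otimes\epsilon_\delta[X])\circ\delta_\sim$ is $\mathrm{Id}$ if $\sim$ is the equality and $0$ otherwise, and $\sum_{\sim\in\mathcal{E}[X]}(\epsilon_\delta[X/\sim]\otimes\mathrm{Id})\circ\delta_\sim=\mathrm{Id}_{\mathbf{P}[X]}$. For a twisted bialgebra $(\mathbf{P},m,\Delta)$ with unit $1_{\mathbf{P}}$ and counit $\varepsilon_\Delta$, $\delta$ is compatible with $m$ and $\Delta$ if for all finite $X,Y$ and $\sim\in\mathcal{E}[X\sqcup Y]$, with $\sim_X=\sim\cap X^2$, $\sim_Y=\sim\cap Y^2$ and $c$ the flip: $\delta_\sim\circ m_{X,Y}$ equals $(m_{X/\sim_X,Y/\sim_Y}\otimes m_{X,Y})\circ(\mathrm{Id}\otimes c\otimes\mathrm{Id})\circ(\delta_{\sim_X}\otimes\delta_{\sim_Y})$ if $\sim=\sim_X\sqcup\sim_Y$ and $0$ otherwise; $(\Delta_{X/\sim_X,Y/\sim_Y}\otimes\mathrm{Id})\circ\delta_\sim=m_{1,3,24}\circ(\delta_{\sim_X}\otimes\delta_{\sim_Y})\circ\Delta_{X,Y}$ if $\sim=\sim_X\sqcup\sim_Y$, where $m_{1,3,24}(a\otimes b\otimes a'\otimes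 b')=a\otimes a'\otimes m_{X,Y}(b\otimes b')$; and, $\sim_\emptyset$ being the equivalence on $\emptyset$, $\delta_{\sim_\emptyset}(1_{\mathbf{P}})=1_{\mathbf{P}}\otimes1_{\mathbf{P}}$ and $(\varepsilon_\Delta\otimes\mathrm{Id})\circ\delta_{\sim_\emptyset}(x)=\varepsilon_\Delta(x)1_{\mathbf{P}}$ for $x\in\mathbf{P}[\emptyset]$. *)

theory Defs
  imports "HOL-Library.Poly_Mapping" "HOL-Library.FSet"
begin

section \<open>Finite sets closed under quotients\<close>

text \<open>
  A species has to be evaluated both at a finite set \<open>X\<close> and at its quotients \<open>X/\<sim>\<close>, \<open>(X/\<sim>')/\<sim>\<close>.
  So all finite sets are taken from one universe, the hereditarily finite sets over
  atoms of an arbitrary type \<open>'a\<close>, in which a finite set of elements, hence a class of an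
  equivalence relation, is again an element. Every finite set \<open>A\<close> over \<open>'a\<close> occurs as
  \<open>Atom ` A\<close>.
\<close>

datatype 'a obj = Atom 'a | Cls "'a obj fset"

text \<open>\<open>cls\<close> is meaningful, and injective, on finite sets only.\<close>

definition cls :: "'a obj set \<Rightarrow> 'a obj" where
  "cls C = Cls (Abs_fset C)"

primrec elts :: "'a obj \<Rightarrow> 'a obj set" where
  "elts (Atom a) = {}"
| "elts (Cls F) = fset F"

definition quot :: "'a obj set \<Rightarrow> ('a obj \<times> 'a obj) set \<Rightarrow> 'a obj set" where
  "quot X r = cls ` (X // r)"

definition cl :: "('a obj \<times> 'a obj) set \<Rightarrow> 'a obj \<Rightarrow> 'a obj" where
  "cl r x = cls (r `` {x})"

definition transport :: "('a obj \<Rightarrow> 'a obj) \<Rightarrow> ('a obj \<times> 'a obj) set \<Rightarrow> ('a obj \<times> 'a obj) set" where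
  "transport \<sigma> r = map_prod \<sigma> \<sigma> ` r"

definition quot_map :: "('a obj \<Rightarrow> 'a obj) \<Rightarrow> 'a obj \<Rightarrow> 'a obj" where
  "quot_map \<sigma> c = cls (\<sigma> ` elts c)"

text \<open>Finer relations are larger: the equality is the greatest element.\<close>

definition eq_le :: "('a obj \<times> 'a obj) set \<Rightarrow> ('a obj \<times> 'a obj) set \<Rightarrow> bool" where
  "eq_le r r' \<longleftrightarrow> (\<forall>x y. (x, y) \<in> r' \<longrightarrow> (x, y) \<in> r)"

text \<open>
  If \<open>r \<le> r'\<close>, then \<open>quot_rel r r'\<close> is the equivalence on \<open>X/r'\<close> identified with \<open>r\<close>, and
  \<open>flat\<close>, which sends a class of classes to their union, is the identification
  \<open>(X/r')/r \<rightarrow> X/r\<close>.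
\<close>

definition quot_rel :: "('a obj \<times> 'a obj) set \<Rightarrow> ('a obj \<times> 'a obj) set \<Rightarrow> ('a obj \<times> 'a obj) set" where
  "quot_rel r r' = map_prod (cl r') (cl r') ` r"

definition flat :: "'a obj \<Rightarrow> 'a obj" where
  "flat q = cls (\<Union>c\<in>elts q. elts c)"


section \<open>Vector spaces with a basis\<close>

text \<open>
  The space with basis \<open>B\<close> consists of the finitely supported functions with support in
  \<open>B\<close>. The tensor product of the spaces with bases \<open>B\<close> and \<open>C\<close> is the space with basis
  \<open>B \<times> C\<close>, where \<open>b \<otimes> c\<close> is the basis vector \<open>(b, c)\<close>.
\<close>

definition vspace :: "'b set \<Rightarrow> ('b \<Rightarrow>\<^sub>0 'k::field) set" where
  "vspace B = {v. Poly_Mapping.keys v \<subseteq> B}"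

definition bvec :: "'b \<Rightarrow> ('b \<Rightarrow>\<^sub>0 'k::field)" where
  "bvec b = Poly_Mapping.single b 1"

definition smul :: "'k::field \<Rightarrow> ('b \<Rightarrow>\<^sub>0 'k) \<Rightarrow> ('b \<Rightarrow>\<^sub>0 'k)" where
  "smul c v = Poly_Mapping.map ((*) c) v"

definition linear_map :: "'b set \<Rightarrow> 'c set \<Rightarrow> (('b \<Rightarrow>\<^sub>0 'k::field) \<Rightarrow> ('c \<Rightarrow>\<^sub>0 'k)) \<Rightarrow> bool" where
  "linear_map B C f \<longleftrightarrow>
     (\<forall>v\<in>vspace B. f v \<in> vspace C) \<and>
     (\<forall>u\<in>vspace B. \<forall>v\<in>vspace B. f (u + v) = f u + f v) \<and>
     (\<forall>c. \<forall>v\<in>vspace B. f (smul c v) = smul c (f v))"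

definition linear_form :: "'b set \<Rightarrow> (('b \<Rightarrow>\<^sub>0 'k::field) \<Rightarrow> 'k) \<Rightarrow> bool" where
  "linear_form B \<phi> \<longleftrightarrow>
     (\<forall>u\<in>vspace B. \<forall>v\<in>vspace B. \<phi> (u + v) = \<phi> u + \<phi> v) \<and>
     (\<forall>c. \<forall>v\<in>vspace B. \<phi> (smul c v) = c * \<phi> v)"

definition lin_ext :: "('b \<Rightarrow> ('c \<Rightarrow>\<^sub>0 'k::field)) \<Rightarrow> ('b \<Rightarrow>\<^sub>0 'k) \<Rightarrow> ('c \<Rightarrow>\<^sub>0 'k)" where
  "lin_ext f v = (\<Sum>b\<in>Poly_Mapping.keys v. smul (Poly_Mapping.lookup v b) (f b))"

definition tensor :: "('b \<Rightarrow>\<^sub>0 'k::field) \<Rightarrow> ('c \<Rightarrow>\<^sub>0 'k) \<Rightarrow> ('b \<times> 'c \<Rightarrow>\<^sub>0 'k)"  (infixr \<open>\<otimes>\<close> 75) where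
  "v \<otimes> w = lin_ext (\<lambda>b. lin_ext (\<lambda>c. bvec (b, c)) w) v"

text \<open>
  Tensor products of linear maps are determined by their values on the basis vectors
  \<open>b \<otimes> c\<close>. When one factor is a linear form, \<open>V \<otimes> K\<close> and \<open>K \<otimes> V\<close> are identified with \<open>V\<close>.
\<close>

definition tensor_map ::
  "(('b \<Rightarrow>\<^sub>0 'k::field) \<Rightarrow> ('d \<Rightarrow>\<^sub>0 'k)) \<Rightarrow> (('c \<Rightarrow>\<^sub>0 'k) \<Rightarrow> ('e \<Rightarrow>\<^sub>0 'k)) \<Rightarrow>
   ('b \<times> 'c \<Rightarrow>\<^sub>0 'k) \<Rightarrow> ('d \<times> 'e \<Rightarrow>\<^sub>0 'k)"  (infixr \<open>\<otimes>\<^sub>m\<close> 75) where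
  "f \<otimes>\<^sub>m g = lin_ext (\<lambda>(b, c). f (bvec b) \<otimes> g (bvec c))"

definition tensor_form_right ::
  "(('c \<Rightarrow>\<^sub>0 'k::field) \<Rightarrow> 'k) \<Rightarrow> ('b \<times> 'c \<Rightarrow>\<^sub>0 'k) \<Rightarrow> ('b \<Rightarrow>\<^sub>0 'k)"  (\<open>Id'_\<otimes>\<close>) where
  "Id_\<otimes> \<phi> = lin_ext (\<lambda>(b, c). smul (\<phi> (bvec c)) (bvec b))"

definition tensor_form_left ::
  "(('b \<Rightarrow>\<^sub>0 'k::field) \<Rightarrow> 'k) \<Rightarrow> ('b \<times> 'c \<Rightarrow>\<^sub>0 'k) \<Rightarrow> ('c \<Rightarrow>\<^sub>0 'k)"  (\<open>\<otimes>'_Id\<close>) where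
  "\<otimes>_Id \<phi> = lin_ext (\<lambda>(b, c). smul (\<phi> (bvec b)) (bvec c))"

definition reindex :: "('b \<Rightarrow> 'c) \<Rightarrow> ('b \<Rightarrow>\<^sub>0 'k::field) \<Rightarrow> ('c \<Rightarrow>\<^sub>0 'k)" where
  "reindex h = lin_ext (\<lambda>b. bvec (h b))"

definition assoc :: "(('b \<times> 'c) \<times> 'd \<Rightarrow>\<^sub>0 'k::field) \<Rightarrow> ('b \<times> 'c \<times> 'd \<Rightarrow>\<^sub>0 'k)" where
  "assoc = reindex (\<lambda>((b, c), d). (b, (c, d)))"

definition middle_flip ::
  "(('b \<times> 'c) \<times> ('d \<times> 'e) \<Rightarrow>\<^sub>0 'k::field) \<Rightarrow> (('b \<times> 'd) \<times> ('c \<times> 'e) \<Rightarrow>\<^sub>0 'k)" where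
  "middle_flip = reindex (\<lambda>((b, c), (d, e)). ((b, d), (c, e)))"


section \<open>Species and contraction-extraction coproducts\<close>

text \<open>
  \<open>P[X]\<close> is \<open>vspace (B X)\<close>, and \<open>act X \<sigma>\<close> is \<open>P[\<sigma>]\<close> for a bijection \<open>\<sigma>\<close> with domain \<open>X\<close>, which
  is given by a function whose values outside \<open>X\<close> are irrelevant (law \<open>act_cong\<close>).
\<close>

locale species =
  fixes B :: "'a obj set \<Rightarrow> 'b set"
    and act :: "'a obj set \<Rightarrow> ('a obj \<Rightarrow> 'a obj) \<Rightarrow> ('b \<Rightarrow>\<^sub>0 'k::field) \<Rightarrow> ('b \<Rightarrow>\<^sub>0 'k)"
  assumes act_linear:
      "\<lbrakk>finite X; bij_betw \<sigma> X Y\<rbrakk> \<Longrightarrow> linear_map (B X) (B Y) (act X \<sigma>)"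
    and act_cong:
      "\<lbrakk>finite X; bij_betw \<sigma> X Y; \<And>x. x \<in> X \<Longrightarrow> \<sigma> x = \<tau> x; v \<in> vspace (B X)\<rbrakk>
         \<Longrightarrow> act X \<sigma> v = act X \<tau> v"
    and act_id:
      "\<lbrakk>finite X; v \<in> vspace (B X)\<rbrakk> \<Longrightarrow> act X id v = v"
    and act_comp:
      "\<lbrakk>finite X; bij_betw \<sigma> X Y; bij_betw \<tau> Y Z; v \<in> vspace (B X)\<rbrakk>
         \<Longrightarrow> act X (\<tau> \<circ> \<sigma>) v = act Y \<tau> (act X \<sigma> v)"

text \<open>
  The set \<open>X\<close> is the field of any equivalence relation on it, so \<open>\<delta>\<close> is indexed by the
  relation only. In \<open>counit_right\<close>, the identification of \<open>P[X]\<close> with \<open>P[X/=]\<close> is the action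
  of the bijection sending \<open>x\<close> to the class \<open>{x}\<close>.
\<close>

locale contraction_extraction_coproduct = species B act
  for B :: "'a obj set \<Rightarrow> 'b set"
    and act :: "'a obj set \<Rightarrow> ('a obj \<Rightarrow> 'a obj) \<Rightarrow> ('b \<Rightarrow>\<^sub>0 'k::field) \<Rightarrow> ('b \<Rightarrow>\<^sub>0 'k)" +
  fixes \<delta> :: "('a obj \<times> 'a obj) set \<Rightarrow> ('b \<Rightarrow>\<^sub>0 'k) \<Rightarrow> ('b \<times> 'b \<Rightarrow>\<^sub>0 'k)"
  assumes delta_linear:
      "\<lbrakk>finite X; equiv X r\<rbrakk> \<Longrightarrow> linear_map (B X) (B (quot X r) \<times> B X) (\<delta> r)"
    and naturality:
      "\<lbrakk>finite X; equiv X r; bij_betw \<sigma> X Y; v \<in> vspace (B X)\<rbrakk>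
         \<Longrightarrow> \<delta> (transport \<sigma> r) (act X \<sigma> v) =
             (act (quot X r) (quot_map \<sigma>) \<otimes>\<^sub>m act X \<sigma>) (\<delta> r v)"
    and coassociativity:
      "\<lbrakk>finite X; equiv X r; equiv X r'; eq_le r r'; v \<in> vspace (B X)\<rbrakk>
         \<Longrightarrow> assoc (((\<lambda>u. (act (quot (quot X r') (quot_rel r r')) flat \<otimes>\<^sub>m id)
                              (\<delta> (quot_rel r r') u)) \<otimes>\<^sub>m id) (\<delta> r' v)) =
             (id \<otimes>\<^sub>m \<delta> r') (\<delta> r v)"
    and vanishing:
      "\<lbrakk>finite X; equiv X r; equiv X r'; \<not> eq_le r r'; v \<in> vspace (B X)\<rbrakk>
         \<Longrightarrow> (id \<otimes>\<^sub>m \<delta> r') (\<delta> r v) = 0"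
    and counit:
      "\<exists>\<epsilon> :: 'a obj set \<Rightarrow> ('b \<Rightarrow>\<^sub>0 'k) \<Rightarrow> 'k.
         (\<forall>X. finite X \<longrightarrow> linear_form (B X) (\<epsilon> X)) \<and>
         (\<forall>X Y \<sigma>. finite X \<longrightarrow> bij_betw \<sigma> X Y \<longrightarrow>
            (\<forall>v\<in>vspace (B X). \<epsilon> Y (act X \<sigma> v) = \<epsilon> X v)) \<and>
         (\<forall>X r. finite X \<longrightarrow> equiv X r \<longrightarrow>
            (\<forall>v\<in>vspace (B X). Id_\<otimes> (\<epsilon> X) (\<delta> r v) =
               (if r = Id_on X then act X (cl r) v else 0))) \<and>
         (\<forall>X. finite X \<longrightarrow>
            (\<forall>v\<in>vspace (B X). (\<Sum>r | equiv X r. \<otimes>_Id (\<epsilon> (quot X r)) (\<delta> r v)) = v))"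

text \<open>
  Disjoint unions are internal: the product and coproduct maps \<open>m X Y\<close> and \<open>\<Delta> X Y\<close>
  are used for disjoint \<open>X\<close> and \<open>Y\<close> only. The quotients of disjoint sets are disjoint,
  and \<open>(X \<union> Y)/\<sim>\<close> is equal to \<open>X/\<sim>\<^sub>X \<union> Y/\<sim>\<^sub>Y\<close> if \<open>\<sim>\<close> is \<open>\<sim>\<^sub>X \<squnion> \<sim>\<^sub>Y\<close>.
\<close>

definition restr :: "('a obj \<times> 'a obj) set \<Rightarrow> 'a obj set \<Rightarrow> ('a obj \<times> 'a obj) set" where
  "restr r X = r \<inter> X \<times> X"

definition m_1_3_24 ::
  "(('b \<times> 'b \<Rightarrow>\<^sub>0 'k::field) \<Rightarrow> ('b \<Rightarrow>\<^sub>0 'k)) \<Rightarrow>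
   (('b \<times> 'b) \<times> ('b \<times> 'b) \<Rightarrow>\<^sub>0 'k) \<Rightarrow> (('b \<times> 'b) \<times> 'b \<Rightarrow>\<^sub>0 'k)" where
  "m_1_3_24 m t = (id \<otimes>\<^sub>m m) (middle_flip t)"

definition compatible_product ::
  "('a obj set \<Rightarrow> 'b set) \<Rightarrow>
   ('a obj set \<Rightarrow> 'a obj set \<Rightarrow> ('b \<times> 'b \<Rightarrow>\<^sub>0 'k::field) \<Rightarrow> ('b \<Rightarrow>\<^sub>0 'k)) \<Rightarrow> ('b \<Rightarrow>\<^sub>0 'k) \<Rightarrow>
   (('a obj \<times> 'a obj) set \<Rightarrow> ('b \<Rightarrow>\<^sub>0 'k) \<Rightarrow> ('b \<times> 'b \<Rightarrow>\<^sub>0 'k)) \<Rightarrow> bool" where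
  "compatible_product B m one \<delta> \<longleftrightarrow>
     (\<forall>X Y r. finite X \<longrightarrow> finite Y \<longrightarrow> X \<inter> Y = {} \<longrightarrow> equiv (X \<union> Y) r \<longrightarrow>
        (\<forall>t\<in>vspace (B X \<times> B Y).
           \<delta> r (m X Y t) =
             (if r = restr r X \<union> restr r Y
              then (m (quot X (restr r X)) (quot Y (restr r Y)) \<otimes>\<^sub>m m X Y)
                     (middle_flip ((\<delta> (restr r X) \<otimes>\<^sub>m \<delta> (restr r Y)) t))
              else 0))) \<and>
     \<delta> {} one = one \<otimes> one"

definition compatible_coproduct ::
  "('a obj set \<Rightarrow> 'b set) \<Rightarrow>
   ('a obj set \<Rightarrow> 'a obj set \<Rightarrow> ('b \<times> 'b \<Rightarrow>\<^sub>0 'k::field) \<Rightarrow> ('b \<Rightarrow>\<^sub>0 'k)) \<Rightarrow> ('b \<Rightarrow>\<^sub>0 'k) \<Rightarrow>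
   ('a obj set \<Rightarrow> 'a obj set \<Rightarrow> ('b \<Rightarrow>\<^sub>0 'k) \<Rightarrow> ('b \<times> 'b \<Rightarrow>\<^sub>0 'k)) \<Rightarrow> (('b \<Rightarrow>\<^sub>0 'k) \<Rightarrow> 'k) \<Rightarrow>
   (('a obj \<times> 'a obj) set \<Rightarrow> ('b \<Rightarrow>\<^sub>0 'k) \<Rightarrow> ('b \<times> 'b \<Rightarrow>\<^sub>0 'k)) \<Rightarrow> bool" where
  "compatible_coproduct B m one \<Delta> \<epsilon>\<^sub>\<Delta> \<delta> \<longleftrightarrow>
     (\<forall>X Y r. finite X \<longrightarrow> finite Y \<longrightarrow> X \<inter> Y = {} \<longrightarrow> equiv (X \<union> Y) r \<longrightarrow>
        r = restr r X \<union> restr r Y \<longrightarrow>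
        (\<forall>v\<in>vspace (B (X \<union> Y)).
           (\<Delta> (quot X (restr r X)) (quot Y (restr r Y)) \<otimes>\<^sub>m id) (\<delta> r v) =
             m_1_3_24 (m X Y) ((\<delta> (restr r X) \<otimes>\<^sub>m \<delta> (restr r Y)) (\<Delta> X Y v)))) \<and>
     (\<forall>v\<in>vspace (B {}). \<otimes>_Id \<epsilon>\<^sub>\<Delta> (\<delta> {} v) = smul (\<epsilon>\<^sub>\<Delta> v) one)"


section \<open>Graphs\<close>

type_synonym 'v graph = "'v set \<times> 'v set set"

definition graphs :: "'v set \<Rightarrow> 'v graph set" where
  "graphs X = {(V, E). V = X \<and> E \<subseteq> {{x, y} |x y. x \<in> X \<and> y \<in> X \<and> x \<noteq> y}}"

definition relabel :: "('v \<Rightarrow> 'v) \<Rightarrow> 'v graph \<Rightarrow> 'v graph" where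
  "relabel \<sigma> G = (\<sigma> ` fst G, (\<lambda>e. \<sigma> ` e) ` snd G)"

definition graph_union :: "'v graph \<Rightarrow> 'v graph \<Rightarrow> 'v graph" where
  "graph_union G H = (fst G \<union> fst H, snd G \<union> snd H)"

definition empty_graph :: "'v graph" where
  "empty_graph = ({}, {})"

definition induced :: "'v graph \<Rightarrow> 'v set \<Rightarrow> 'v graph" where
  "induced G A = (A, {e \<in> snd G. e \<subseteq> A})"

definition connected_graph :: "'v graph \<Rightarrow> bool" where
  "connected_graph G \<longleftrightarrow>
     fst G \<noteq> {} \<and> (\<forall>x\<in>fst G. \<forall>y\<in>fst G. (x, y) \<in> {(u, v). {u, v} \<in> snd G}\<^sup>*)"

definition extraction :: "'v graph \<Rightarrow> ('v \<times> 'v) set \<Rightarrow> 'v graph" where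
  "extraction G r = (fst G, {{x, y} |x y. {x, y} \<in> snd G \<and> (x, y) \<in> r})"

definition contraction :: "'a obj graph \<Rightarrow> ('a obj \<times> 'a obj) set \<Rightarrow> 'a obj graph" where
  "contraction G r =
     (quot (fst G) r, {{cl r x, cl r y} |x y. {x, y} \<in> snd G \<and> cl r x \<noteq> cl r y})"

definition Ec :: "'v graph \<Rightarrow> ('v \<times> 'v) set set" where
  "Ec G = {r. equiv (fst G) r \<and> (\<forall>C \<in> fst G // r. connected_graph (induced G C))}"

definition graph_act ::
  "'a obj set \<Rightarrow> ('a obj \<Rightarrow> 'a obj) \<Rightarrow> ('a obj graph \<Rightarrow>\<^sub>0 'k::field) \<Rightarrow> ('a obj graph \<Rightarrow>\<^sub>0 'k)" where
  "graph_act X \<sigma> = lin_ext (\<lambda>G. bvec (relabel \<sigma> G))"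

definition graph_m ::
  "'a obj set \<Rightarrow> 'a obj set \<Rightarrow>
   ('a obj graph \<times> 'a obj graph \<Rightarrow>\<^sub>0 'k::field) \<Rightarrow> ('a obj graph \<Rightarrow>\<^sub>0 'k)" where
  "graph_m X Y = lin_ext (\<lambda>(G, H). bvec (graph_union G H))"

definition graph_one :: "'a obj graph \<Rightarrow>\<^sub>0 'k::field" where
  "graph_one = bvec empty_graph"

definition graph_Delta ::
  "'a obj set \<Rightarrow> 'a obj set \<Rightarrow>
   ('a obj graph \<Rightarrow>\<^sub>0 'k::field) \<Rightarrow> ('a obj graph \<times> 'a obj graph \<Rightarrow>\<^sub>0 'k)" where
  "graph_Delta X Y = lin_ext (\<lambda>G. bvec (induced G X) \<otimes> bvec (induced G Y))"

text \<open>The empty graph is the only element of \<open>graphs {}\<close>, so the counit is its coefficient.\<close>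

definition graph_counit :: "('a obj graph \<Rightarrow>\<^sub>0 'k::field) \<Rightarrow> 'k" where
  "graph_counit v = Poly_Mapping.lookup v empty_graph"

definition graph_delta ::
  "('a obj \<times> 'a obj) set \<Rightarrow>
   ('a obj graph \<Rightarrow>\<^sub>0 'k::field) \<Rightarrow> ('a obj graph \<times> 'a obj graph \<Rightarrow>\<^sub>0 'k)" where
  "graph_delta r =
     lin_ext (\<lambda>G. if r \<in> Ec G then bvec (contraction G r) \<otimes> bvec (extraction G r) else 0)"

end

theory Submission
  imports Defs
begin

text \<open>
  All the maps involved are linear, so each law is checked on basis vectors, where it is a
  statement about graphs. Both sides of coassociativity send \<open>G\<close> to
  \<open>G/\<sim> \<otimes> (G|\<sim>)/\<sim>' \<otimes> G|\<sim>'\<close>, or to \<open>0\<close>: once the classes of \<open>\<sim>'\<close> are connected,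
  a union of such classes is connected in \<open>G\<close> iff it is connected in \<open>G/\<sim>'\<close>. The counit is the
  coefficient of the edgeless graph: if the classes of \<open>\<sim>\<close> are connected, \<open>G|\<sim>\<close> is edgeless
  iff \<open>\<sim>\<close> is the equality, and \<open>G/\<sim>\<close> is edgeless iff the classes of \<open>\<sim>\<close> are the connected
  components of \<open>G\<close>, in which case \<open>G|\<sim> = G\<close>. For a disjoint union of graphs, a connected
  class lies on one side, so relations which are not split contribute nothing.
\<close>

section \<open>Linear maps and bases\<close>

lemma lookup_smul [simp]:
  "Poly_Mapping.lookup (smul c v) b = c * Poly_Mapping.lookup v b"
  by (simp add: smul_def Poly_Mapping.map.rep_eq when_def)

lemma lookup_bvec:
  "Poly_Mapping.lookup (bvec b) c = (if b = c then 1 else 0)"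
  by (simp add: bvec_def lookup_single when_def)

lemma smul_zero_right [simp]: "smul c 0 = 0"
  by (rule poly_mapping_eqI) simp

lemma smul_zero_left [simp]: "smul 0 v = 0"
  by (rule poly_mapping_eqI) simp

lemma smul_one [simp]: "smul 1 v = v"
  by (rule poly_mapping_eqI) simp

lemma smul_smul [simp]: "smul c (smul d v) = smul (c * d) v"
  by (rule poly_mapping_eqI) (simp add: mult.assoc)

lemma smul_add_right: "smul c (u + v) = smul c u + smul c v"
  by (rule poly_mapping_eqI) (simp add: lookup_add algebra_simps)

lemma smul_add_left: "smul (c + d) v = smul c v + smul d v"
  by (rule poly_mapping_eqI) (simp add: lookup_add algebra_simps)

lemma smul_sum: "smul c (sum f S) = (\<Sum>x\<in>S. smul c (f x))"
  by (induction S rule: infinite_finite_induct) (simp_all add: smul_add_right)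

lemma vspace_UNIV [simp]: "vspace UNIV = UNIV"
  by (simp add: vspace_def)

lemma vspace_zero [simp]: "0 \<in> vspace B"
  by (simp add: vspace_def)

lemma vspace_bvec [simp]: "bvec b \<in> vspace B \<longleftrightarrow> b \<in> B"
  by (simp add: vspace_def bvec_def)

lemma vspace_add: "u \<in> vspace B \<Longrightarrow> v \<in> vspace B \<Longrightarrow> u + v \<in> vspace B"
  unfolding vspace_def using Poly_Mapping.keys_add[of u v] by blast

lemma vspace_smul: "v \<in> vspace B \<Longrightarrow> smul c v \<in> vspace B"
  by (auto simp: vspace_def in_keys_iff)

text \<open>Induction on the support: subtracting the term of \<open>v\<close> at \<open>b\<close>
  removes exactly \<open>b\<close> from it. Besides linear maps this also serves for equations
  between linear forms.\<close>

lemma vspace_induct [consumes 1, case_names zero add]: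
  fixes v :: "'b \<Rightarrow>\<^sub>0 'k::field"
  assumes "v \<in> vspace B" and "P 0"
    and "\<And>c b u. b \<in> B \<Longrightarrow> u \<in> vspace B \<Longrightarrow> P u \<Longrightarrow> P (smul c (bvec b) + u)"
  shows "P v"
proof -
  have "v \<in> vspace B \<longrightarrow> P v" if "finite K" "Poly_Mapping.keys v = K" for K and v :: "'b \<Rightarrow>\<^sub>0 'k"
    using that
  proof (induction K arbitrary: v)
    case empty
    then show ?case using assms(2) by simp
  next
    case (insert b K)
    define u where "u = v - smul (Poly_Mapping.lookup v b) (bvec b)"
    have l: "Poly_Mapping.lookup u c = (if c = b then 0 else Poly_Mapping.lookup v c)" for c
      by (auto simp: u_def lookup_minus lookup_bvec)
    have k: "Poly_Mapping.keys u = K"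
      using insert.hyps(2) insert.prems by (auto simp: in_keys_iff l set_eq_iff split: if_splits)
    have v: "smul (Poly_Mapping.lookup v b) (bvec b) + u = v"
      by (simp add: u_def)
    show ?case
    proof
      assume "v \<in> vspace B"
      then have "b \<in> B" "u \<in> vspace B"
        using insert.prems k by (auto simp: vspace_def)
      then show "P v"
        using assms(3) insert.IH[OF k] v by metis
    qed
  qed
  from this[OF finite_keys refl] assms(1) show ?thesis by simp
qed

section \<open>Linear maps and their values on basis vectors\<close>

lemma linear_map_UNIV:
  "linear_map UNIV UNIV f \<longleftrightarrow>
     (\<forall>u v. f (u + v) = f u + f v) \<and> (\<forall>c v. f (smul c v) = smul c (f v))"
  by (simp add: linear_map_def)

lemma linear_map_zero:
  assumes "linear_map UNIV UNIV f"
  shows "f 0 = 0"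
  using assms unfolding linear_map_UNIV by (metis smul_zero_left)

text \<open>The reduction of every later law to graphs. Linearity is asked on the whole type, which
  every \<open>lin_ext\<close> satisfies, so composites can be handled without tracking the spaces
  in between; only the agreement is restricted to \<open>B\<close>.\<close>

lemma linear_map_eqI:
  assumes "linear_map UNIV UNIV f" "linear_map UNIV UNIV g"
    and "\<And>b. b \<in> B \<Longrightarrow> f (bvec b) = g (bvec b)" and "v \<in> vspace B"
  shows "f v = g v"
  using assms(4)
proof (induction rule: vspace_induct)
  case zero
  show ?case using assms(1,2) by (simp add: linear_map_zero)
next
  case (add c b u)
  then show ?case using assms(1,2,3) by (simp add: linear_map_UNIV)
qed

lemma linear_mapI:
  assumes "linear_map UNIV UNIV f" and "\<And>b. b \<in> B \<Longrightarrow> f (bvec b) \<in> vspace C"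
  shows "linear_map B C f"
proof -
  have "f v \<in> vspace C" if "v \<in> vspace B" for v
    using that
  proof (induction rule: vspace_induct)
    case zero
    show ?case using assms(1) by (simp add: linear_map_zero)
  next
    case (add c b u)
    then show ?case using assms by (simp add: linear_map_UNIV vspace_add vspace_smul)
  qed
  then show ?thesis using assms(1) by (simp add: linear_map_def)
qed

lemma linear_map_id: "linear_map UNIV UNIV (\<lambda>v. v)"
  by (simp add: linear_map_UNIV)

text \<open>Allows a common range of summation for vectors with different supports, the extra terms
  having coefficient 0.\<close>

lemma lin_ext_superset:
  assumes "finite S" "Poly_Mapping.keys v \<subseteq> S"
  shows "lin_ext f v = (\<Sum>b\<in>S. smul (Poly_Mapping.lookup v b) (f b))"
  unfolding lin_ext_def using assms
  by (intro sum.mono_neutral_left) (auto simp: in_keys_iff)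

lemma linear_lin_ext:
  fixes f :: "'b \<Rightarrow> ('c \<Rightarrow>\<^sub>0 'k::field)"
  shows "linear_map UNIV UNIV (lin_ext f)"
  unfolding linear_map_UNIV
proof (intro conjI allI)
  fix u v :: "'b \<Rightarrow>\<^sub>0 'k"
  define S where "S = Poly_Mapping.keys u \<union> Poly_Mapping.keys v"
  have S: "finite S" "Poly_Mapping.keys u \<subseteq> S" "Poly_Mapping.keys v \<subseteq> S"
    "Poly_Mapping.keys (u + v) \<subseteq> S"
    using Poly_Mapping.keys_add[of u v] by (auto simp: S_def)
  show "lin_ext f (u + v) = lin_ext f u + lin_ext f v"
    using S by (simp add: lin_ext_superset[of S] lookup_add smul_add_left sum.distrib)
next
  fix c and v :: "'b \<Rightarrow>\<^sub>0 'k"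
  have "Poly_Mapping.keys (smul c v) \<subseteq> Poly_Mapping.keys v"
    by (auto simp: in_keys_iff)
  then show "lin_ext f (smul c v) = smul c (lin_ext f v)"
    by (simp add: lin_ext_superset[of "Poly_Mapping.keys v"] smul_sum)
qed

section \<open>Values of the structure maps on basis vectors\<close>

lemma lin_ext_bvec [simp]: "lin_ext f (bvec b) = f b"
  by (simp add: lin_ext_def bvec_def)

lemma lin_ext_zero [simp]: "lin_ext f 0 = 0"
  by (simp add: lin_ext_def)

lemma tensor_bvec [simp]: "bvec b \<otimes> bvec c = bvec (b, c)"
  by (simp add: tensor_def)

lemma tensor_zero_left [simp]: "0 \<otimes> w = 0"
  by (simp add: tensor_def)

lemma tensor_zero_right [simp]: "v \<otimes> 0 = 0"
  by (simp add: tensor_def) (simp add: lin_ext_def)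

lemma tensor_map_bvec [simp]: "(f \<otimes>\<^sub>m g) (bvec (b, c)) = f (bvec b) \<otimes> g (bvec c)"
  by (simp add: tensor_map_def)

lemma tensor_map_zero [simp]: "(f \<otimes>\<^sub>m g) 0 = 0"
  by (simp add: tensor_map_def)

lemma tensor_form_right_bvec [simp]: "(Id_\<otimes> \<phi>) (bvec (b, c)) = smul (\<phi> (bvec c)) (bvec b)"
  by (simp add: tensor_form_right_def)

lemma tensor_form_right_zero [simp]: "(Id_\<otimes> \<phi>) 0 = 0"
  by (simp add: tensor_form_right_def)

lemma tensor_form_left_bvec [simp]: "(\<otimes>_Id \<phi>) (bvec (b, c)) = smul (\<phi> (bvec b)) (bvec c)"
  by (simp add: tensor_form_left_def)

lemma tensor_form_left_zero [simp]: "(\<otimes>_Id \<phi>) 0 = 0"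
  by (simp add: tensor_form_left_def)

lemma reindex_bvec [simp]: "reindex h (bvec b) = bvec (h b)"
  by (simp add: reindex_def)

lemma reindex_zero [simp]: "reindex h 0 = 0"
  by (simp add: reindex_def)

lemma graph_act_bvec [simp]: "graph_act X \<sigma> (bvec G) = bvec (relabel \<sigma> G)"
  by (simp add: graph_act_def)

lemma graph_act_zero [simp]: "graph_act X \<sigma> 0 = 0"
  by (simp add: graph_act_def)

lemma graph_m_bvec [simp]: "graph_m X Y (bvec (G, H)) = bvec (graph_union G H)"
  by (simp add: graph_m_def)

lemma graph_Delta_bvec [simp]: "graph_Delta X Y (bvec G) = bvec (induced G X, induced G Y)"
  by (simp add: graph_Delta_def)

lemma graph_delta_bvec:
  "graph_delta r (bvec G) = (if r \<in> Ec G then bvec (contraction G r, extraction G r) else 0)"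
  by (simp add: graph_delta_def)

lemma graph_delta_zero [simp]: "graph_delta r 0 = 0"
  by (simp add: graph_delta_def)

section \<open>Linearity of the structure maps\<close>

lemma linear_tensor_map: "linear_map UNIV UNIV (f \<otimes>\<^sub>m g)"
  by (simp add: tensor_map_def linear_lin_ext)

lemma linear_tensor_form_right: "linear_map UNIV UNIV (Id_\<otimes> \<phi>)"
  by (simp add: tensor_form_right_def linear_lin_ext)

lemma linear_tensor_form_left: "linear_map UNIV UNIV (\<otimes>_Id \<phi>)"
  by (simp add: tensor_form_left_def linear_lin_ext)

lemma linear_reindex: "linear_map UNIV UNIV (reindex h)"
  by (simp add: reindex_def linear_lin_ext)

lemma linear_graph_act: "linear_map UNIV UNIV (graph_act X \<sigma>)"
  by (simp add: graph_act_def linear_lin_ext)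

lemma linear_graph_m: "linear_map UNIV UNIV (graph_m X Y)"
  by (simp add: graph_m_def linear_lin_ext)

lemma linear_graph_Delta: "linear_map UNIV UNIV (graph_Delta X Y)"
  by (simp add: graph_Delta_def linear_lin_ext)

lemma linear_graph_delta: "linear_map UNIV UNIV (graph_delta r)"
  by (simp add: graph_delta_def linear_lin_ext)

text \<open>Additivity and homogeneity as rewrite rules, by which simplification proves composites
  of structure maps linear.\<close>

lemmas linear_simps =
  linear_tensor_map[unfolded linear_map_UNIV] linear_tensor_form_right[unfolded linear_map_UNIV]
  linear_tensor_form_left[unfolded linear_map_UNIV] linear_reindex[unfolded linear_map_UNIV]
  linear_graph_act[unfolded linear_map_UNIV] linear_graph_m[unfolded linear_map_UNIV]
  linear_graph_Delta[unfolded linear_map_UNIV] linear_graph_delta[unfolded linear_map_UNIV]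


section \<open>Classes and quotients\<close>

lemma elts_cls [simp]: "finite C \<Longrightarrow> elts (cls C) = C"
  by (simp add: cls_def Abs_fset_inverse)

lemma equiv_finite_class: "finite X \<Longrightarrow> equiv X r \<Longrightarrow> finite (r `` {x})"
  by (rule finite_subset[of _ X]) (auto simp: equiv_def)

lemma elts_cl: "finite X \<Longrightarrow> equiv X r \<Longrightarrow> elts (cl r x) = r `` {x}"
  by (simp add: cl_def equiv_finite_class)

text \<open>The classes are recovered from the objects by \<open>elts\<close>, which is where
  finiteness enters.\<close>

lemma cl_eq_iff:
  assumes "finite X" "equiv X r" "x \<in> X" "y \<in> X"
  shows "cl r x = cl r y \<longleftrightarrow> (x, y) \<in> r"
proof
  assume "cl r x = cl r y"
  then have "r `` {x} = r `` {y}"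
    using assms by (metis elts_cl)
  then show "(x, y) \<in> r"
    using assms by (simp add: eq_equiv_class_iff)
next
  assume "(x, y) \<in> r"
  then show "cl r x = cl r y"
    using assms(2) by (simp add: cl_def equiv_class_eq)
qed

lemma quot_eq: "quot X r = cl r ` X"
  by (auto simp: quot_def quotient_def cl_def)

lemma finite_quot: "finite X \<Longrightarrow> finite (quot X r)"
  by (simp add: quot_eq)

text \<open>For a split relation the class of a point of \<open>X\<close> stays inside
  \<open>X\<close>, so restricting changes nothing and the two quotients share the very same
  elements.\<close>

lemma cl_restr:
  assumes "X \<inter> Y = {}" "r = restr r X \<union> restr r Y" "x \<in> X"
  shows "cl (restr r X) x = cl r x"
proof -
  have "restr r X `` {x} = r `` {x}"
    using assms by (auto simp: restr_def)
  then show ?thesis by (simp add: cl_def)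
qed

lemma equiv_restr: "equiv (X \<union> Y) r \<Longrightarrow> equiv X (restr r X)"
  unfolding equiv_def refl_on_def sym_def trans_def restr_def by blast

lemma equiv_transport:
  assumes "equiv X r" "bij_betw \<sigma> X Y"
  shows "equiv Y (transport \<sigma> r)"
proof -
  have inj: "inj_on \<sigma> X" and Y: "Y = \<sigma> ` X"
    using assms(2) by (auto simp: bij_betw_def)
  have r: "r \<subseteq> X \<times> X" and refl: "\<And>x. x \<in> X \<Longrightarrow> (x, x) \<in> r" and "sym r" "trans r"
    using assms(1) by (auto simp: equiv_def refl_on_def)
  show ?thesis
  proof (rule equivI)
    show "transport \<sigma> r \<subseteq> Y \<times> Y"
      using r by (auto simp: transport_def Y)
    show "refl_on Y (transport \<sigma> r)"
      using refl by (force simp: transport_def Y refl_on_def)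
    show "sym (transport \<sigma> r)"
      using \<open>sym r\<close> by (force simp: transport_def sym_def)
    show "trans (transport \<sigma> r)"
    proof (rule transI)
      fix x y z
      assume "(x, y) \<in> transport \<sigma> r" "(y, z) \<in> transport \<sigma> r"
      then obtain a b b' c where *: "(a, b) \<in> r" "(b', c) \<in> r" "\<sigma> b = \<sigma> b'"
        "x = \<sigma> a" "z = \<sigma> c"
        by (auto simp: transport_def)
      \<comment> \<open>Injectivity makes the two preimages of the middle point coincide, so that
        transitivity of \<open>r\<close> applies.\<close>
      with r inj have "b = b'"
        by (auto dest!: inj_onD[of \<sigma> X b b'])
      with * \<open>trans r\<close> have "(a, c) \<in> r"
        by (blast dest: transD)
      with * show "(x, z) \<in> transport \<sigma> r"
        by (force simp: transport_def)
    qed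
  qed
qed

lemma transport_Image:
  assumes "inj_on \<sigma> X" "r \<subseteq> X \<times> X" "x \<in> X"
  shows "transport \<sigma> r `` {\<sigma> x} = \<sigma> ` (r `` {x})"
  using assms by (force simp: transport_def dest: inj_onD)

lemma quot_map_cl:
  assumes "finite X" "equiv X r" "inj_on \<sigma> X" "x \<in> X"
  shows "quot_map \<sigma> (cl r x) = cl (transport \<sigma> r) (\<sigma> x)"
proof -
  have "r \<subseteq> X \<times> X"
    using assms(2) by (auto simp: equiv_def)
  then show ?thesis
    using assms by (simp add: quot_map_def elts_cl) (simp add: cl_def transport_Image)
qed

text \<open>Since \<open>r'\<close> is contained in \<open>r\<close>, replacing representatives of
  \<open>r'\<close>-classes does not affect membership in \<open>r\<close>.\<close>

lemma mem_quot_rel_iff: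
  assumes "finite X" "equiv X r" "equiv X r'" "r' \<subseteq> r" "x \<in> X" "y \<in> X"
  shows "(cl r' x, cl r' y) \<in> quot_rel r r' \<longleftrightarrow> (x, y) \<in> r"
proof
  assume "(cl r' x, cl r' y) \<in> quot_rel r r'"
  then obtain a b where ab: "(a, b) \<in> r" "cl r' x = cl r' a" "cl r' y = cl r' b"
    by (auto simp: quot_rel_def)
  moreover have "a \<in> X" "b \<in> X"
    using ab(1) assms(2) by (auto simp: equiv_def)
  ultimately have "(x, a) \<in> r" "(b, y) \<in> r"
    using assms by (metis cl_eq_iff subsetD)+
  then show "(x, y) \<in> r"
    using ab(1) assms(2) unfolding equiv_def by (meson transD)
qed (force simp: quot_rel_def)

lemma equiv_quot_rel:
  assumes "finite X" "equiv X r" "equiv X r'" "r' \<subseteq> r"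
  shows "equiv (quot X r') (quot_rel r r')"
proof -
  have r: "r \<subseteq> X \<times> X" and "refl_on X r" "sym r" "trans r"
    using assms(2) by (auto simp: equiv_def)
  note iff = mem_quot_rel_iff[OF assms]
  show ?thesis
  proof (rule equivI)
    show 1: "quot_rel r r' \<subseteq> quot X r' \<times> quot X r'"
      using r by (auto simp: quot_rel_def quot_eq)
    show "refl_on (quot X r') (quot_rel r r')"
      using \<open>refl_on X r\<close> by (auto simp: refl_on_def quot_eq iff)
    show "sym (quot_rel r r')"
      using \<open>sym r\<close> by (force simp: quot_rel_def sym_def)
    show "trans (quot_rel r r')"
    proof (rule transI)
      fix x y z
      assume *: "(x, y) \<in> quot_rel r r'" "(y, z) \<in> quot_rel r r'"
      then have "x \<in> quot X r'" "y \<in> quot X r'" "z \<in> quot X r'"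
        using 1 by auto
      then obtain a b c where "a \<in> X" "b \<in> X" "c \<in> X" "x = cl r' a" "y = cl r' b" "z = cl r' c"
        by (auto simp: quot_eq)
      with * show "(x, z) \<in> quot_rel r r'"
        using \<open>trans r\<close> by (simp add: iff) (blast dest: transD)
    qed
  qed
qed

text \<open>The class of \<open>cl r' x\<close> under \<open>quot_rel r r'\<close> consists of the
  \<open>r'\<close>-classes of the points related to \<open>x\<close> by \<open>r\<close>. Their
  union is the \<open>r\<close>-class of \<open>x\<close>, because \<open>r'\<close> is reflexive on
  \<open>X\<close> and contained in \<open>r\<close>.\<close>

lemma flat_cl:
  assumes "finite X" "equiv X r" "equiv X r'" "r' \<subseteq> r" "x \<in> X"
  shows "flat (cl (quot_rel r r') (cl r' x)) = cl r x"
proof -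
  have r: "r \<subseteq> X \<times> X"
    using assms(2) by (auto simp: equiv_def)
  have q: "equiv (quot X r') (quot_rel r r')"
    using assms by (intro equiv_quot_rel)
  have "quot_rel r r' `` {cl r' x} = cl r' ` (r `` {x})"
  proof -
    have "(cl r' x, c) \<in> quot_rel r r' \<longleftrightarrow> c \<in> cl r' ` (r `` {x})" for c
    proof
      assume *: "(cl r' x, c) \<in> quot_rel r r'"
      then obtain y where "y \<in> X" "c = cl r' y"
        using r by (auto simp: quot_rel_def)
      with * show "c \<in> cl r' ` (r `` {x})"
        using mem_quot_rel_iff[OF assms(1-5)] by auto
    qed (force simp: quot_rel_def)
    then show ?thesis by auto
  qed
  then have "elts (cl (quot_rel r r') (cl r' x)) = cl r' ` (r `` {x})"
    using elts_cl[OF finite_quot q] assms(1) by simp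
  moreover have "(\<Union>y\<in>r `` {x}. r' `` {y}) = r `` {x}"
  proof -
    have "trans r" "\<And>y. y \<in> X \<Longrightarrow> (y, y) \<in> r'"
      using assms(2,3) by (auto simp: equiv_def refl_on_def)
    then show ?thesis
      using r assms(4) by (auto dest: transD)
  qed
  ultimately show ?thesis
    using assms(1,3) by (simp add: flat_def elts_cl) (simp add: cl_def)
qed


section \<open>Graphs and their adjacency relations\<close>

text \<open>Ordered pairs in place of two-element sets: the graph operations then become
  intersections, unions and images of relations, and paths become reflexive transitive
  closures.\<close>

definition adj :: "'v graph \<Rightarrow> ('v \<times> 'v) set" where
  "adj G = {(x, y). {x, y} \<in> snd G}"

lemma sym_adj: "sym (adj G)"
  by (auto simp: adj_def sym_def insert_commute)

lemma fst_graphs: "G \<in> graphs X \<Longrightarrow> fst G = X"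
  by (auto simp: graphs_def)

lemma adj_graphs: "G \<in> graphs X \<Longrightarrow> adj G \<subseteq> X \<times> X - Id"
  by (fastforce simp: adj_def graphs_def doubleton_eq_iff)

lemma graphsI:
  assumes "fst G = X" and "\<And>e. e \<in> snd G \<Longrightarrow> \<exists>x\<in>X. \<exists>y\<in>X. x \<noteq> y \<and> e = {x, y}"
  shows "G \<in> graphs X"
  using assms by (cases G) (fastforce simp: graphs_def)

lemma edge_graphsE:
  assumes "G \<in> graphs X" "e \<in> snd G"
  obtains x y where "x \<in> X" "y \<in> X" "x \<noteq> y" "e = {x, y}" "(x, y) \<in> adj G"
  using assms by (fastforce simp: graphs_def adj_def)

text \<open>Every edge is a pair of vertices, so the vertex set and the adjacency relation determine
  a graph. The identities between graphs below are mostly proved this way.\<close>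

lemma graph_eqI:
  assumes "G \<in> graphs X" "H \<in> graphs X" "adj G = adj H"
  shows "G = H"
proof -
  have "snd G \<subseteq> snd H" if "G \<in> graphs X" "adj G = adj H" for G H :: "'a graph"
  proof
    fix e assume "e \<in> snd G"
    with that(1) obtain x y where "e = {x, y}" "(x, y) \<in> adj G"
      by (rule edge_graphsE)
    moreover from this that(2) have "(x, y) \<in> adj H"
      by simp
    ultimately show "e \<in> snd H"
      by (simp add: adj_def)
  qed
  from this[of G H] this[of H G] assms show ?thesis
    by (simp add: prod_eq_iff fst_graphs)
qed

lemma relabel_graphs:
  assumes "G \<in> graphs X" "inj_on \<sigma> X"
  shows "relabel \<sigma> G \<in> graphs (\<sigma> ` X)"
proof (rule graphsI)
  fix e assume "e \<in> snd (relabel \<sigma> G)"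
  then obtain d where "d \<in> snd G" "e = \<sigma> ` d"
    by (auto simp: relabel_def)
  with assms show "\<exists>x\<in>\<sigma> ` X. \<exists>y\<in>\<sigma> ` X. x \<noteq> y \<and> e = {x, y}"
    by (auto elim!: edge_graphsE dest: inj_onD)
qed (use assms in \<open>simp add: relabel_def fst_graphs\<close>)

lemma adj_relabel:
  assumes "G \<in> graphs X"
  shows "adj (relabel \<sigma> G) = map_prod \<sigma> \<sigma> ` adj G"
proof
  show "adj (relabel \<sigma> G) \<subseteq> map_prod \<sigma> \<sigma> ` adj G"
  proof
    fix p assume "p \<in> adj (relabel \<sigma> G)"
    then obtain u v d where p: "p = (u, v)" "d \<in> snd G" "{u, v} = \<sigma> ` d"
      by (auto simp: adj_def relabel_def)
    from assms p(2) obtain x y where "d = {x, y}" "(x, y) \<in> adj G"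
      by (rule edge_graphsE)
    \<comment> \<open>The unordered edge may match \<open>(u, v)\<close> in the reversed
      order.\<close>
    moreover from this have "(y, x) \<in> adj G"
      using sym_adj[of G] by (blast dest: symD)
    ultimately show "p \<in> map_prod \<sigma> \<sigma> ` adj G"
      using p by (auto simp: doubleton_eq_iff)
  qed
  show "map_prod \<sigma> \<sigma> ` adj G \<subseteq> adj (relabel \<sigma> G)"
  proof clarsimp
    fix x y assume "(x, y) \<in> adj G"
    then have "\<sigma> ` {x, y} \<in> snd (relabel \<sigma> G)"
      unfolding relabel_def adj_def by (simp del: image_insert)
    then show "(\<sigma> x, \<sigma> y) \<in> adj (relabel \<sigma> G)"
      by (simp add: adj_def)
  qed
qed

lemma induced_graphs: "G \<in> graphs Y \<Longrightarrow> induced G X \<in> graphs X"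
  by (rule graphsI) (auto simp: induced_def elim!: edge_graphsE)

lemma adj_induced: "adj (induced G X) = adj G \<inter> X \<times> X"
  by (auto simp: adj_def induced_def)

lemma graph_union_graphs:
  "G \<in> graphs X \<Longrightarrow> H \<in> graphs Y \<Longrightarrow> graph_union G H \<in> graphs (X \<union> Y)"
  by (rule graphsI) (auto simp: graph_union_def fst_graphs elim!: edge_graphsE)

lemma adj_graph_union: "adj (graph_union G H) = adj G \<union> adj H"
  by (auto simp: adj_def graph_union_def)

lemma extraction_graphs: "G \<in> graphs X \<Longrightarrow> extraction G r \<in> graphs X"
  by (rule graphsI) (auto simp: extraction_def fst_graphs elim!: edge_graphsE)

lemma adj_extraction: "sym r \<Longrightarrow> adj (extraction G r) = adj G \<inter> r"
  by (auto simp: adj_def extraction_def doubleton_eq_iff insert_commute dest: symD)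

lemma contraction_graphs:
  assumes "G \<in> graphs X"
  shows "contraction G r \<in> graphs (quot X r)"
proof (rule graphsI)
  fix e assume "e \<in> snd (contraction G r)"
  then obtain x y where "(x, y) \<in> adj G" "e = {cl r x, cl r y}" "cl r x \<noteq> cl r y"
    by (auto simp: contraction_def adj_def)
  then show "\<exists>a\<in>quot X r. \<exists>b\<in>quot X r. a \<noteq> b \<and> e = {a, b}"
    using adj_graphs[OF assms] by (auto simp: quot_eq)
qed (use assms in \<open>simp add: contraction_def fst_graphs\<close>)

text \<open>Removing the diagonal discards the edges inside a class, which would become
  loops.\<close>

lemma adj_contraction: "adj (contraction G r) = map_prod (cl r) (cl r) ` adj G - Id"
proof -
  have "(u, v) \<in> adj (contraction G r) \<longleftrightarrow> (u, v) \<in> map_prod (cl r) (cl r) ` adj G - Id" for u v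
  proof
    assume "(u, v) \<in> adj (contraction G r)"
    then obtain x y where "(x, y) \<in> adj G" "{u, v} = {cl r x, cl r y}" "cl r x \<noteq> cl r y"
      by (auto simp: contraction_def adj_def)
    then show "(u, v) \<in> map_prod (cl r) (cl r) ` adj G - Id"
      using symD[OF sym_adj, of _ _ G] by (auto simp: doubleton_eq_iff)
  qed (auto simp: contraction_def adj_def)
  then show ?thesis by auto
qed

lemma graphs_empty: "graphs {} = {empty_graph}"
  by (auto simp: graphs_def empty_graph_def)

lemma edgeless_iff: "G \<in> graphs X \<Longrightarrow> G = (X, {}) \<longleftrightarrow> adj G = {}"
  by (auto simp: adj_def fst_graphs elim: edge_graphsE intro!: prod_eqI)


section \<open>Relations with connected classes\<close>

text \<open>
  In this form, all statements on connectedness become inclusions between reflexive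
  transitive closures.
\<close>

lemma Ec_iff:
  assumes "G \<in> graphs X" "equiv X r"
  shows "r \<in> Ec G \<longleftrightarrow> r \<subseteq> (adj G \<inter> r)\<^sup>*"
proof -
  have r: "r \<subseteq> X \<times> X" "\<And>x. x \<in> X \<Longrightarrow> (x, x) \<in> r" "sym r" "trans r"
    using assms(2) by (auto simp: equiv_def refl_on_def)
  have conn: "connected_graph (induced G C) \<longleftrightarrow> C \<noteq> {} \<and> (\<forall>x\<in>C. \<forall>y\<in>C. (x, y) \<in> (adj G \<inter> C \<times> C)\<^sup>*)" for C
    using adj_induced[of G C] by (simp add: connected_graph_def adj_def) (simp add: induced_def)
  show ?thesis
  proof
    assume "r \<in> Ec G"
    show "r \<subseteq> (adj G \<inter> r)\<^sup>*"
    proof clarify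
      fix x y assume xy: "(x, y) \<in> r"
      define C where "C = r `` {x}"
      have "x \<in> X" using xy r by auto
      then have "C \<in> X // r" "x \<in> C" "y \<in> C"
        using xy r by (auto simp: C_def quotientI)
      then have "(x, y) \<in> (adj G \<inter> C \<times> C)\<^sup>*"
        using \<open>r \<in> Ec G\<close> by (simp add: Ec_def fst_graphs[OF assms(1)] conn)
      \<comment> \<open>Edges inside one class are edges inside \<open>r\<close>, so a path in the
        induced subgraph on \<open>C\<close> is a path for \<open>adj G \<inter> r\<close>.\<close>
      moreover have "C \<times> C \<subseteq> r"
        using r by (auto simp: C_def dest: symD transD)
      ultimately show "(x, y) \<in> (adj G \<inter> r)\<^sup>*"
        using rtrancl_mono[of "adj G \<inter> C \<times> C" "adj G \<inter> r"] by blast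
    qed
  next
    assume *: "r \<subseteq> (adj G \<inter> r)\<^sup>*"
    have "connected_graph (induced G C)" if "C \<in> X // r" for C
    proof -
      \<comment> \<open>A path with steps in \<open>r\<close> never leaves the class in which it
        starts, hence runs in the induced subgraph on \<open>C\<close>.\<close>
      have "(x, y) \<in> (adj G \<inter> C \<times> C)\<^sup>* \<and> y \<in> C" if "x \<in> C" "(x, y) \<in> (adj G \<inter> r)\<^sup>*" for x y
        using that(2)
      proof induction
        case base
        then show ?case using \<open>x \<in> C\<close> by simp
      next
        case (step y z)
        then have "z \<in> C"
          using in_quotient_imp_closed[OF assms(2) \<open>C \<in> X // r\<close>] by blast
        with step show ?case
          by (auto intro: rtrancl_into_rtrancl)
      qed
      moreover have "(x, y) \<in> r" if "x \<in> C" "y \<in> C" for x y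
        using in_quotient_imp_in_rel[OF assms(2) \<open>C \<in> X // r\<close>] that by simp
      ultimately show ?thesis
        using * in_quotient_imp_non_empty[OF assms(2) \<open>C \<in> X // r\<close>] unfolding conn by blast
    qed
    then show "r \<in> Ec G"
      using assms by (simp add: Ec_def fst_graphs)
  qed
qed

section \<open>Connected classes under extraction and contraction\<close>

lemma EcD_equiv: "r \<in> Ec G \<Longrightarrow> equiv (fst G) r"
  by (simp add: Ec_def)

lemma equiv_sym: "equiv X r \<Longrightarrow> sym r"
  by (simp add: equiv_def)

text \<open>The edges inside \<open>r'\<close> are inside \<open>r\<close> too, so all of them
  survive in the extraction by \<open>r\<close>.\<close>

lemma Ec_extraction_iff:
  assumes "G \<in> graphs X" "equiv X r" "equiv X r'" "r' \<subseteq> r"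
  shows "r' \<in> Ec (extraction G r) \<longleftrightarrow> r' \<in> Ec G"
proof -
  have "adj G \<inter> r \<inter> r' = adj G \<inter> r'"
    using assms(4) by blast
  then show ?thesis
    using assms by (simp add: Ec_iff[of _ X] extraction_graphs adj_extraction equiv_sym)
qed

text \<open>Points related by \<open>r'\<close> are joined by a path of edges inside
  \<open>r\<close>, and \<open>r\<close> is transitive. This gives the vanishing law.\<close>

lemma Ec_extraction_imp_subset:
  assumes "G \<in> graphs X" "equiv X r" "equiv X r'" "r' \<in> Ec (extraction G r)"
  shows "r' \<subseteq> r"
proof -
  have r: "trans r" "\<And>x. x \<in> X \<Longrightarrow> (x, x) \<in> r" and r': "r' \<subseteq> X \<times> X"
    using assms(2,3) by (auto simp: equiv_def refl_on_def)
  have "r' \<subseteq> (adj G \<inter> r \<inter> r')\<^sup>*"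
    using assms by (simp add: Ec_iff[of _ X] extraction_graphs adj_extraction equiv_sym)
  also have "\<dots> \<subseteq> r\<^sup>*"
    by (rule rtrancl_mono) blast
  also have "r\<^sup>* = r\<^sup>="
    using r(1) by (metis rtrancl_trancl_reflcl trancl_id)
  finally show ?thesis
    using r(2) r' by auto
qed

text \<open>Paths project to the quotient, where steps inside an \<open>r'\<close>-class collapse.
  Conversely each quotient edge lifts to an edge of \<open>G\<close>, and the gaps between
  consecutive lifted edges are bridged inside the connected \<open>r'\<close>-classes.\<close>

lemma Ec_contraction_iff:
  assumes "finite X" "G \<in> graphs X" "equiv X r" "r' \<in> Ec G" "r' \<subseteq> r"
  shows "quot_rel r r' \<in> Ec (contraction G r') \<longleftrightarrow> r \<in> Ec G"
proof -
  have eq': "equiv X r'"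
    using EcD_equiv[OF assms(4)] by (simp add: fst_graphs[OF assms(2)])
  have r: "r \<subseteq> X \<times> X" "trans r"
    using assms(3) by (auto simp: equiv_def)
  define q where "q = quot_rel r r'"
  define A where "A = adj (contraction G r')"
  have A: "A = map_prod (cl r') (cl r') ` adj G - Id"
    by (simp add: A_def adj_contraction)
  have q_iff: "(cl r' x, cl r' y) \<in> q \<longleftrightarrow> (x, y) \<in> r" if "x \<in> X" "y \<in> X" for x y
    unfolding q_def by (rule mem_quot_rel_iff[OF assms(1,3) eq' assms(5) that])
  have r'_path: "r' \<subseteq> (adj G \<inter> r)\<^sup>*"
  proof -
    have "r' \<subseteq> (adj G \<inter> r')\<^sup>*"
      using assms(4) Ec_iff[OF assms(2) eq'] by simp
    also have "\<dots> \<subseteq> (adj G \<inter> r)\<^sup>*"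
      using assms(5) by (intro rtrancl_mono) blast
    finally show ?thesis .
  qed
  have "q \<subseteq> (A \<inter> q)\<^sup>* \<longleftrightarrow> r \<subseteq> (adj G \<inter> r)\<^sup>*"
  proof
    assume *: "r \<subseteq> (adj G \<inter> r)\<^sup>*"
    have "(cl r' x, cl r' y) \<in> (A \<inter> q)\<^sup>*" if "(x, y) \<in> (adj G \<inter> r)\<^sup>*" for x y
      using that
    proof induction
      case (step y z)
      then have "cl r' y = cl r' z \<or> (cl r' y, cl r' z) \<in> A \<inter> q"
        by (force simp: A q_def quot_rel_def)
      with step.IH show ?case
        by (auto intro: rtrancl_into_rtrancl)
    qed simp
    then show "q \<subseteq> (A \<inter> q)\<^sup>*"
      using * by (auto simp: q_def quot_rel_def)
  next
    assume *: "q \<subseteq> (A \<inter> q)\<^sup>*"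
    \<comment> \<open>The claim covers all representatives \<open>y\<close> of the end class, so
      that the induction can continue from whichever endpoint \<open>u\<close> the next lifted edge
      has.\<close>
    have lift: "\<forall>y\<in>X. c = cl r' y \<longrightarrow> (x, y) \<in> (adj G \<inter> r)\<^sup>*"
      if "(cl r' x, c) \<in> (A \<inter> q)\<^sup>*" "x \<in> X" for x c
      using that(1)
    proof induction
      case base
      show ?case
        using that(2) r'_path cl_eq_iff[OF assms(1) eq'] by blast
    next
      case (step c d)
      from step.hyps(2) obtain u w where uw: "c = cl r' u" "d = cl r' w" "(u, w) \<in> adj G"
        by (auto simp: A)
      then have X: "u \<in> X" "w \<in> X"
        using adj_graphs[OF assms(2)] by auto
      then have "(u, w) \<in> r"
        using step.hyps(2) uw q_iff by simp
      with uw X step.IH have "(x, w) \<in> (adj G \<inter> r)\<^sup>*"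
        by (blast intro: rtrancl_into_rtrancl)
      moreover have "(w, z) \<in> (adj G \<inter> r)\<^sup>*" if "z \<in> X" "d = cl r' z" for z
      proof -
        have "(w, z) \<in> r'"
          using that uw(2) X cl_eq_iff[OF assms(1) eq'] by simp
        then show ?thesis using r'_path by blast
      qed
      ultimately show ?case
        by (blast intro: rtrancl_trans)
    qed
    show "r \<subseteq> (adj G \<inter> r)\<^sup>*"
    proof clarify
      fix x y assume xy: "(x, y) \<in> r"
      then have "x \<in> X" "y \<in> X"
        using r by auto
      with xy * lift[of x "cl r' y"] q_iff[of x y] show "(x, y) \<in> (adj G \<inter> r)\<^sup>*"
        by blast
    qed
  qed
  moreover have "equiv (quot X r') q"
    unfolding q_def by (rule equiv_quot_rel[OF assms(1,3) eq' assms(5)])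
  ultimately show ?thesis
    using Ec_iff[OF contraction_graphs[OF assms(2)], of r' q] Ec_iff[OF assms(2,3)]
    by (simp add: q_def A_def)
qed

text \<open>For iterated contractions: diagonal pairs stay diagonal under the second map, so
  discarding loops in between loses nothing.\<close>

lemma map_prod_image_minus_Id:
  "map_prod f f ` (map_prod g g ` A - Id) - Id = map_prod (f \<circ> g) (f \<circ> g) ` A - Id" (is "?L = ?R")
proof
  have "?R = map_prod f f ` map_prod g g ` A - Id"
    by (simp add: image_comp map_prod.comp)
  then show "?L \<subseteq> ?R"
    by blast
  show "?R \<subseteq> ?L"
  proof (intro subsetI, elim DiffE imageE)
    fix p z assume z: "p \<notin> Id" "p = map_prod (f \<circ> g) (f \<circ> g) z" "z \<in> A"
    obtain x y where "z = (x, y)"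
      by (cases z)
    with z have xy: "(x, y) \<in> A" "f (g x) \<noteq> f (g y)" and p: "p = (f (g x), f (g y))"
      by auto
    show "p \<in> ?L"
      unfolding p using xy by (intro DiffI map_prod_imageI) auto
  qed
qed

text \<open>For a contraction followed by a relabelling: the condition says that \<open>g\<close>
  and \<open>h\<close> turn the same pairs into loops.\<close>

lemma map_prod_image_minus_Id_eq:
  assumes "\<And>x y. (x, y) \<in> A \<Longrightarrow> f (g x) = h x \<and> f (g y) = h y \<and> (g x = g y \<longleftrightarrow> h x = h y)"
  shows "map_prod f f ` (map_prod g g ` A - Id) = map_prod h h ` A - Id" (is "?L = ?R")
proof
  show "?L \<subseteq> ?R"
  proof
    fix p assume "p \<in> ?L"
    then obtain x y where xy: "(x, y) \<in> A" "g x \<noteq> g y" and p: "p = (f (g x), f (g y))"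
      by auto
    show "p \<in> ?R"
      unfolding p using xy assms[OF xy(1)] by auto
  qed
  show "?R \<subseteq> ?L"
  proof
    fix p assume "p \<in> ?R"
    then obtain x y where xy: "(x, y) \<in> A" "h x \<noteq> h y" and "p = (h x, h y)"
      by auto
    then have p: "p = (f (g x), f (g y))"
      using assms by simp
    show "p \<in> ?L"
      unfolding p using xy assms[OF xy(1)] by (intro DiffI map_prod_imageI) auto
  qed
qed

lemma relabel_flat_contraction:
  assumes "finite X" "G \<in> graphs X" "equiv X r" "equiv X r'" "r' \<subseteq> r"
  shows "relabel flat (contraction (contraction G r') (quot_rel r r')) = contraction G r"
proof (rule graph_eqI)
  let ?q = "quot_rel r r'"
  note flat = flat_cl[OF assms(1,3,4,5)]
  have q: "equiv (quot X r') ?q"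
    by (rule equiv_quot_rel[OF assms(1,3,4,5)])
  have quot: "quot (quot X r') ?q = (\<lambda>x. cl ?q (cl r' x)) ` X"
    by (simp add: quot_eq image_image)
  have im: "flat ` quot (quot X r') ?q = quot X r"
    by (simp add: quot image_image flat) (simp add: quot_eq)
  \<comment> \<open>Both equalities amount to \<open>x\<close> and \<open>y\<close> being related by
    \<open>r\<close>. Hence \<open>flat\<close> is injective on the iterated quotient, and the same
    loops are discarded on both sides.\<close>
  have cl: "cl ?q (cl r' x) = cl ?q (cl r' y) \<longleftrightarrow> cl r x = cl r y" if "x \<in> X" "y \<in> X" for x y
    using that assms(1) mem_quot_rel_iff[OF assms(1,3,4,5) that] cl_eq_iff[OF assms(1,3) that]
      cl_eq_iff[OF finite_quot[OF assms(1)] q, of "cl r' x" "cl r' y"]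
    by (simp add: quot_eq)
  have inj: "inj_on flat (quot (quot X r') ?q)"
    by (auto simp: inj_on_def quot flat cl)
  have G2: "contraction (contraction G r') ?q \<in> graphs (quot (quot X r') ?q)"
    using assms(2) by (intro contraction_graphs)
  show "relabel flat (contraction (contraction G r') ?q) \<in> graphs (quot X r)"
    using relabel_graphs[OF G2 inj] by (simp add: im)
  show "contraction G r \<in> graphs (quot X r)"
    using assms(2) by (rule contraction_graphs)
  let ?c = "\<lambda>x. cl ?q (cl r' x)"
  have "map_prod flat flat ` (map_prod (cl ?q \<circ> cl r') (cl ?q \<circ> cl r') ` adj G - Id)
      = map_prod (cl r) (cl r) ` adj G - Id"
    using adj_graphs[OF assms(2)] by (intro map_prod_image_minus_Id_eq) (auto simp: flat cl)
  then show "adj (relabel flat (contraction (contraction G r') ?q)) = adj (contraction G r)"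
    by (simp only: adj_relabel[OF G2] adj_contraction map_prod_image_minus_Id)
qed

lemma extraction_contraction:
  assumes "finite X" "G \<in> graphs X" "equiv X r" "equiv X r'" "r' \<subseteq> r"
  shows "extraction (contraction G r') (quot_rel r r') = contraction (extraction G r) r'"
proof (rule graph_eqI)
  show "extraction (contraction G r') (quot_rel r r') \<in> graphs (quot X r')"
    using assms(2) by (intro extraction_graphs contraction_graphs)
  show "contraction (extraction G r) r' \<in> graphs (quot X r')"
    using assms(2) by (intro extraction_graphs contraction_graphs)
  have "sym (quot_rel r r')"
    using equiv_quot_rel[OF assms(1,3,4,5)] by (rule equiv_sym)
  \<comment> \<open>Membership of the image pair in \<open>quot_rel r r'\<close> is membership of
    the pair itself in \<open>r\<close>, so intersecting commutes with the image.\<close>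
  moreover have "map_prod (cl r') (cl r') ` adj G \<inter> quot_rel r r'
      = map_prod (cl r') (cl r') ` (adj G \<inter> r)"
    using adj_graphs[OF assms(2)] mem_quot_rel_iff[OF assms(1,3,4,5)] by fastforce
  ultimately show "adj (extraction (contraction G r') (quot_rel r r'))
      = adj (contraction (extraction G r) r')"
    using equiv_sym[OF assms(3)] by (auto simp: adj_extraction adj_contraction)
qed

lemma extraction_extraction:
  assumes "G \<in> graphs X" "equiv X r" "equiv X r'" "r' \<subseteq> r"
  shows "extraction (extraction G r) r' = extraction G r'"
  using assms
  by (intro graph_eqI[of _ X]) (auto simp: extraction_graphs adj_extraction equiv_sym)


section \<open>Relabelling\<close>

lemma relabel_comp: "relabel (\<tau> \<circ> \<sigma>) G = relabel \<tau> (relabel \<sigma> G)"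
  by (simp add: relabel_def image_comp o_def)

lemma relabel_id [simp]: "relabel id G = G"
  by (simp add: relabel_def)

lemma relabel_cong:
  assumes "G \<in> graphs X" "\<And>x. x \<in> X \<Longrightarrow> \<sigma> x = \<tau> x"
  shows "relabel \<sigma> G = relabel \<tau> G"
proof -
  have "\<sigma> ` e = \<tau> ` e" if "e \<in> snd G" for e
    using assms(1) that by (rule edge_graphsE) (simp add: assms(2))
  then show ?thesis
    using assms by (simp add: relabel_def fst_graphs cong: image_cong)
qed

lemma relabel_inv_into:
  assumes "G \<in> graphs X" "inj_on \<sigma> X"
  shows "relabel (inv_into X \<sigma>) (relabel \<sigma> G) = G"
proof -
  have "relabel (inv_into X \<sigma> \<circ> \<sigma>) G = relabel id G"
    using assms by (intro relabel_cong) auto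
  then show ?thesis by (simp add: relabel_comp)
qed

lemma transport_inv_into:
  assumes "r \<subseteq> X \<times> X" "inj_on \<sigma> X"
  shows "transport (inv_into X \<sigma>) (transport \<sigma> r) = r"
proof -
  have "map_prod (inv_into X \<sigma> \<circ> \<sigma>) (inv_into X \<sigma> \<circ> \<sigma>) ` r = id ` r"
    using assms by (intro image_cong) auto
  then show ?thesis
    by (simp add: transport_def image_comp map_prod.comp)
qed

text \<open>The bijection carries each path inside \<open>r\<close> to a path inside the transported
  relation.\<close>

lemma Ec_relabel:
  assumes "G \<in> graphs X" "bij_betw \<sigma> X Y" "r \<in> Ec G"
  shows "transport \<sigma> r \<in> Ec (relabel \<sigma> G)"
proof -
  have eq: "equiv X r"
    using EcD_equiv[OF assms(3)] by (simp add: fst_graphs[OF assms(1)])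
  have G': "relabel \<sigma> G \<in> graphs Y"
    using relabel_graphs[OF assms(1), of \<sigma>] assms(2) by (auto simp: bij_betw_def)
  have path: "(\<sigma> x, \<sigma> y) \<in> (adj (relabel \<sigma> G) \<inter> transport \<sigma> r)\<^sup>*"
    if "(x, y) \<in> (adj G \<inter> r)\<^sup>*" for x y
    using that
  proof induction
    case (step y z)
    then have "(\<sigma> y, \<sigma> z) \<in> adj (relabel \<sigma> G) \<inter> transport \<sigma> r"
      by (auto simp: adj_relabel[OF assms(1)] transport_def)
    with step.IH show ?case
      by (rule rtrancl_into_rtrancl)
  qed simp
  have "r \<subseteq> (adj G \<inter> r)\<^sup>*"
    using assms(3) Ec_iff[OF assms(1) eq] by simp
  with path have "transport \<sigma> r \<subseteq> (adj (relabel \<sigma> G) \<inter> transport \<sigma> r)\<^sup>*"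
    by (auto simp: transport_def[of \<sigma> r])
  then show ?thesis
    using Ec_iff[OF G' equiv_transport[OF eq assms(2)]] by simp
qed

text \<open>The converse is \<open>Ec_relabel\<close> for the inverse bijection.\<close>

lemma Ec_relabel_iff:
  assumes "G \<in> graphs X" "bij_betw \<sigma> X Y" "equiv X r"
  shows "transport \<sigma> r \<in> Ec (relabel \<sigma> G) \<longleftrightarrow> r \<in> Ec G"
proof
  assume *: "transport \<sigma> r \<in> Ec (relabel \<sigma> G)"
  have inj: "inj_on \<sigma> X" and Y: "\<sigma> ` X = Y" and r: "r \<subseteq> X \<times> X"
    using assms(2,3) by (auto simp: bij_betw_def equiv_def)
  have "relabel \<sigma> G \<in> graphs Y"
    using relabel_graphs[OF assms(1) inj] by (simp add: Y)
  from Ec_relabel[OF this bij_betw_inv_into[OF assms(2)] *] show "r \<in> Ec G"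
    by (simp add: relabel_inv_into[OF assms(1) inj] transport_inv_into[OF r inj])
qed (rule Ec_relabel[OF assms(1,2)])

lemma mem_transport_iff:
  assumes "inj_on \<sigma> X" "r \<subseteq> X \<times> X" "x \<in> X" "y \<in> X"
  shows "(\<sigma> x, \<sigma> y) \<in> transport \<sigma> r \<longleftrightarrow> (x, y) \<in> r"
  using transport_Image[OF assms(1-3)] assms by (auto dest: inj_onD)

lemma contraction_relabel:
  assumes "finite X" "G \<in> graphs X" "bij_betw \<sigma> X Y" "equiv X r"
  shows "contraction (relabel \<sigma> G) (transport \<sigma> r) = relabel (quot_map \<sigma>) (contraction G r)"
proof (rule graph_eqI)
  let ?t = "transport \<sigma> r"
  have inj: "inj_on \<sigma> X" and Y: "Y = \<sigma> ` X" and r: "r \<subseteq> X \<times> X"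
    using assms(3,4) by (auto simp: bij_betw_def equiv_def)
  have t: "equiv Y ?t"
    using assms(4,3) by (rule equiv_transport)
  have qm: "quot_map \<sigma> (cl r x) = cl ?t (\<sigma> x)" if "x \<in> X" for x
    using quot_map_cl[OF assms(1,4) inj that] .
  \<comment> \<open>Classes merge in the same way before and after relabelling. This yields
    injectivity of \<open>quot_map \<sigma>\<close> and agreement of the discarded loops.\<close>
  have cl: "cl ?t (\<sigma> x) = cl ?t (\<sigma> y) \<longleftrightarrow> cl r x = cl r y" if "x \<in> X" "y \<in> X" for x y
    using cl_eq_iff[OF _ t, of "\<sigma> x" "\<sigma> y"] cl_eq_iff[OF assms(1,4) that]
      mem_transport_iff[OF inj r that] that assms(1) by (simp add: Y)
  have quot: "quot_map \<sigma> ` quot X r = quot Y ?t"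
    by (simp add: quot_eq image_image Y qm)
  have "inj_on (quot_map \<sigma>) (quot X r)"
    by (auto simp: inj_on_def quot_eq qm cl)
  from relabel_graphs[OF contraction_graphs[OF assms(2)] this]
  show "relabel (quot_map \<sigma>) (contraction G r) \<in> graphs (quot Y ?t)"
    by (simp add: quot)
  show "contraction (relabel \<sigma> G) ?t \<in> graphs (quot Y ?t)"
    using relabel_graphs[OF assms(2) inj] by (intro contraction_graphs) (simp add: Y)
  have "map_prod (quot_map \<sigma>) (quot_map \<sigma>) ` (map_prod (cl r) (cl r) ` adj G - Id)
      = map_prod (cl ?t \<circ> \<sigma>) (cl ?t \<circ> \<sigma>) ` adj G - Id"
    using adj_graphs[OF assms(2)] by (intro map_prod_image_minus_Id_eq) (auto simp: qm cl)
  then show "adj (contraction (relabel \<sigma> G) ?t) = adj (relabel (quot_map \<sigma>) (contraction G r))"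
    by (simp add: adj_relabel[OF contraction_graphs[OF assms(2)]] adj_relabel[OF assms(2)]
        adj_contraction image_comp map_prod.comp)
qed

lemma extraction_relabel:
  assumes "G \<in> graphs X" "bij_betw \<sigma> X Y" "equiv X r"
  shows "extraction (relabel \<sigma> G) (transport \<sigma> r) = relabel \<sigma> (extraction G r)"
proof (rule graph_eqI)
  have inj: "inj_on \<sigma> X" and Y: "Y = \<sigma> ` X" and r: "r \<subseteq> X \<times> X"
    using assms(2,3) by (auto simp: bij_betw_def equiv_def)
  show "extraction (relabel \<sigma> G) (transport \<sigma> r) \<in> graphs Y"
    using relabel_graphs[OF assms(1) inj] by (intro extraction_graphs) (simp add: Y)
  show "relabel \<sigma> (extraction G r) \<in> graphs Y"
    using relabel_graphs[OF extraction_graphs[OF assms(1)] inj] by (simp add: Y)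
  \<comment> \<open>Injectivity on pairs is what lets the image commute with the
    intersection.\<close>
  have "inj_on (map_prod \<sigma> \<sigma>) (X \<times> X)"
    using inj by (auto simp: inj_on_def)
  then have "map_prod \<sigma> \<sigma> ` (adj G \<inter> r) = map_prod \<sigma> \<sigma> ` adj G \<inter> map_prod \<sigma> \<sigma> ` r"
    using adj_graphs[OF assms(1)] r by (intro inj_on_image_Int[of _ "X \<times> X"]) auto
  then show "adj (extraction (relabel \<sigma> G) (transport \<sigma> r)) = adj (relabel \<sigma> (extraction G r))"
    using equiv_sym[OF equiv_transport[OF assms(3,2)]] equiv_sym[OF assms(3)]
    by (simp add: adj_relabel[OF extraction_graphs[OF assms(1)]] adj_relabel[OF assms(1)]
        adj_extraction) (simp add: transport_def)
qed


section \<open>Disjoint unions\<close>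

text \<open>A path starting in \<open>X\<close> stays there, since a step of \<open>Q\<close> would
  have to start in \<open>Y\<close>.\<close>

lemma rtrancl_Un_disjoint:
  assumes "(x, y) \<in> (P \<union> Q)\<^sup>*" "x \<in> X" "P \<subseteq> X \<times> X" "Q \<subseteq> Y \<times> Y" "X \<inter> Y = {}"
  shows "(x, y) \<in> P\<^sup>*"
proof -
  have "(x, y) \<in> P\<^sup>* \<and> y \<in> X"
    using assms(1)
  proof induction
    case base
    then show ?case using assms(2) by simp
  next
    case (step y z)
    then have "(y, z) \<in> P" "z \<in> X"
      using assms(3-5) by auto
    with step.IH show ?case
      by (auto intro: rtrancl_into_rtrancl)
  qed
  then show ?thesis by simp
qed

text \<open>The edges inside a split relation fall into an \<open>X\<close>-part and a
  \<open>Y\<close>-part, and a path from a point of \<open>X\<close> uses only the first. Edges of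
  \<open>G\<close> between \<open>X\<close> and \<open>Y\<close> are not inside
  \<open>r\<close>.\<close>

lemma Ec_induced:
  assumes "X \<inter> Y = {}" "G \<in> graphs (X \<union> Y)" "equiv (X \<union> Y) r" "r = restr r X \<union> restr r Y"
    and "r \<in> Ec G"
  shows "restr r X \<in> Ec (induced G X)"
proof -
  have "restr r X \<subseteq> (adj G \<inter> X \<times> X \<inter> restr r X)\<^sup>*"
  proof clarify
    fix x y assume xy: "(x, y) \<in> restr r X"
    have "adj G \<inter> r = (adj G \<inter> restr r X) \<union> (adj G \<inter> restr r Y)"
      using assms(4) by blast
    moreover have "r \<subseteq> (adj G \<inter> r)\<^sup>*"
      using assms(5) Ec_iff[OF assms(2,3)] by simp
    then have "(x, y) \<in> (adj G \<inter> r)\<^sup>*"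
      using xy by (auto simp: restr_def)
    ultimately have path: "(x, y) \<in> ((adj G \<inter> restr r X) \<union> (adj G \<inter> restr r Y))\<^sup>*"
      by simp
    have "(x, y) \<in> (adj G \<inter> restr r X)\<^sup>*"
      by (rule rtrancl_Un_disjoint[OF path _ _ _ assms(1)]) (use xy in \<open>auto simp: restr_def\<close>)
    moreover have "adj G \<inter> restr r X = adj G \<inter> X \<times> X \<inter> restr r X"
      by (auto simp: restr_def)
    ultimately show "(x, y) \<in> (adj G \<inter> X \<times> X \<inter> restr r X)\<^sup>*"
      by simp
  qed
  then show ?thesis
    using Ec_iff[OF induced_graphs[OF assms(2)] equiv_restr[OF assms(3)]] by (simp add: adj_induced)
qed

lemma Ec_induced_iff:
  assumes "X \<inter> Y = {}" "G \<in> graphs (X \<union> Y)" "equiv (X \<union> Y) r" "r = restr r X \<union> restr r Y"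
  shows "r \<in> Ec G \<longleftrightarrow> restr r X \<in> Ec (induced G X) \<and> restr r Y \<in> Ec (induced G Y)"
proof
  assume "r \<in> Ec G"
  moreover have "Y \<inter> X = {}" "r = restr r Y \<union> restr r X"
    using assms(1,4) by auto
  ultimately show "restr r X \<in> Ec (induced G X) \<and> restr r Y \<in> Ec (induced G Y)"
    using Ec_induced[OF assms] Ec_induced[of Y X G r] assms(2,3) by (simp add: Un_commute)
next
  assume *: "restr r X \<in> Ec (induced G X) \<and> restr r Y \<in> Ec (induced G Y)"
  have sub: "restr r Z \<subseteq> (adj G \<inter> r)\<^sup>*" if "restr r Z \<in> Ec (induced G Z)" "equiv Z (restr r Z)" for Z
  proof -
    have "restr r Z \<subseteq> (adj G \<inter> Z \<times> Z \<inter> restr r Z)\<^sup>*"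
      using that Ec_iff[OF induced_graphs[OF assms(2)] that(2)] by (simp add: adj_induced)
    also have "\<dots> \<subseteq> (adj G \<inter> r)\<^sup>*"
      by (intro rtrancl_mono) (auto simp: restr_def)
    finally show ?thesis .
  qed
  have "equiv X (restr r X)" "equiv Y (restr r Y)"
    using assms(3) equiv_restr[of X Y r] equiv_restr[of Y X r] by (simp_all add: Un_commute)
  with * sub have "restr r X \<union> restr r Y \<subseteq> (adj G \<inter> r)\<^sup>*"
    by blast
  then show "r \<in> Ec G"
    using Ec_iff[OF assms(2,3)] assms(4) by simp
qed

lemma induced_contraction:
  assumes "finite X" "finite Y" "X \<inter> Y = {}" "G \<in> graphs (X \<union> Y)" "equiv (X \<union> Y) r"
    "r = restr r X \<union> restr r Y"
  shows "induced (contraction G r) (quot X (restr r X)) = contraction (induced G X) (restr r X)"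
proof (rule graph_eqI)
  show "induced (contraction G r) (quot X (restr r X)) \<in> graphs (quot X (restr r X))"
    using contraction_graphs[OF assms(4)] by (rule induced_graphs)
  show "contraction (induced G X) (restr r X) \<in> graphs (quot X (restr r X))"
    using induced_graphs[OF assms(4)] by (rule contraction_graphs)
  have clX: "cl (restr r X) x = cl r x" if "x \<in> X" for x
    using cl_restr[OF assms(3,6) that] .
  \<comment> \<open>As \<open>r\<close> relates no point of \<open>X\<close> to one of
    \<open>Y\<close>, the quotient of \<open>X\<close> contains only classes of points of
    \<open>X\<close>.\<close>
  have in_quot: "cl r x \<in> quot X (restr r X) \<longleftrightarrow> x \<in> X" if "x \<in> X \<union> Y" for x
  proof
    assume "cl r x \<in> quot X (restr r X)"
    then obtain z where z: "z \<in> X" "cl r x = cl r z"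
      by (auto simp: quot_eq clX)
    then have "(x, z) \<in> restr r X \<union> restr r Y"
      using that cl_eq_iff[OF _ assms(5), of x z] assms(1,2,6) by simp
    then show "x \<in> X"
      using z(1) assms(3) by (auto simp: restr_def)
  qed (auto simp: quot_eq clX)
  have "(map_prod (cl r) (cl r) ` adj G - Id) \<inter> quot X (restr r X) \<times> quot X (restr r X)
      = map_prod (cl r) (cl r) ` (adj G \<inter> X \<times> X) - Id" (is "?L = ?R")
  proof
    show "?L \<subseteq> ?R"
    proof
      fix p assume "p \<in> ?L"
      then obtain x y where xy: "(x, y) \<in> adj G" "p = (cl r x, cl r y)" "cl r x \<noteq> cl r y"
        "cl r x \<in> quot X (restr r X)" "cl r y \<in> quot X (restr r X)"
        by auto
      then have "(x, y) \<in> adj G \<inter> X \<times> X"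
        using adj_graphs[OF assms(4)] in_quot by blast
      with xy(2,3) show "p \<in> ?R"
        by auto
    qed
    show "?R \<subseteq> ?L"
      using in_quot by auto
  qed
  also have "\<dots> = map_prod (cl (restr r X)) (cl (restr r X)) ` (adj G \<inter> X \<times> X) - Id"
    by (intro arg_cong2[of _ _ _ _ "(-)"] image_cong) (auto simp: clX)
  finally show "adj (induced (contraction G r) (quot X (restr r X)))
      = adj (contraction (induced G X) (restr r X))"
    by (simp add: adj_contraction adj_induced)
qed

lemma sym_restr: "sym r \<Longrightarrow> sym (restr r X)"
  by (auto simp: restr_def sym_def)

text \<open>Edges of \<open>G\<close> between \<open>X\<close> and \<open>Y\<close> may exist, but
  extraction by a split relation drops them, just as the induced subgraphs do.\<close>

lemma extraction_split:
  assumes "G \<in> graphs (X \<union> Y)" "equiv (X \<union> Y) r" "r = restr r X \<union> restr r Y"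
  shows "graph_union (extraction (induced G X) (restr r X)) (extraction (induced G Y) (restr r Y))
    = extraction G r"
proof (rule graph_eqI)
  show "graph_union (extraction (induced G X) (restr r X)) (extraction (induced G Y) (restr r Y))
      \<in> graphs (X \<union> Y)"
    using assms(1) by (intro graph_union_graphs extraction_graphs induced_graphs)
  show "extraction G r \<in> graphs (X \<union> Y)"
    using assms(1) by (rule extraction_graphs)
  have "adj G \<inter> X \<times> X \<inter> restr r X \<union> adj G \<inter> Y \<times> Y \<inter> restr r Y = adj G \<inter> (restr r X \<union> restr r Y)"
    by (auto simp: restr_def)
  then show "adj (graph_union (extraction (induced G X) (restr r X)) (extraction (induced G Y) (restr r Y)))
      = adj (extraction G r)"
    using equiv_sym[OF assms(2)] assms(3)
    by (simp add: adj_graph_union adj_extraction adj_induced sym_restr)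
qed

text \<open>Exhibits the factors of a product as induced subgraphs, so that the results on those
  serve for the product as well as for the coproduct.\<close>

lemma induced_graph_union:
  assumes "X \<inter> Y = {}" "G \<in> graphs X" "H \<in> graphs Y"
  shows "induced (graph_union G H) X = G" "induced (graph_union G H) Y = H"
proof -
  have "adj G \<subseteq> X \<times> X" "adj H \<subseteq> Y \<times> Y"
    using adj_graphs[OF assms(2)] adj_graphs[OF assms(3)] by auto
  moreover from this assms(1) have "adj H \<inter> X \<times> X = {}" "adj G \<inter> Y \<times> Y = {}"
    by auto
  ultimately have X: "(adj G \<union> adj H) \<inter> X \<times> X = adj G" and Y: "(adj G \<union> adj H) \<inter> Y \<times> Y = adj H"
    by (auto simp: Int_Un_distrib2)
  note ind = induced_graphs[OF graph_union_graphs[OF assms(2,3)]]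
  show "induced (graph_union G H) X = G"
    using ind assms(2) by (rule graph_eqI) (simp add: adj_induced adj_graph_union X)
  show "induced (graph_union G H) Y = H"
    using ind assms(3) by (rule graph_eqI) (simp add: adj_induced adj_graph_union Y)
qed

lemma contraction_graph_union:
  assumes "X \<inter> Y = {}" "G \<in> graphs X" "H \<in> graphs Y" "r = restr r X \<union> restr r Y"
  shows "contraction (graph_union G H) r
    = graph_union (contraction G (restr r X)) (contraction H (restr r Y))"
proof -
  have clX: "cl (restr r X) x = cl r x" if "x \<in> X" for x
    using cl_restr[OF assms(1,4) that] .
  have clY: "cl (restr r Y) y = cl r y" if "y \<in> Y" for y
    using assms(1,4) that by (intro cl_restr[of Y X]) auto
  have quot: "quot (X \<union> Y) r = quot X (restr r X) \<union> quot Y (restr r Y)"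
    by (simp add: quot_eq image_Un clX clY)
  have imX: "map_prod (cl (restr r X)) (cl (restr r X)) ` adj G = map_prod (cl r) (cl r) ` adj G"
    using adj_graphs[OF assms(2)] by (intro image_cong) (auto simp: clX)
  have imY: "map_prod (cl (restr r Y)) (cl (restr r Y)) ` adj H = map_prod (cl r) (cl r) ` adj H"
    using adj_graphs[OF assms(3)] by (intro image_cong) (auto simp: clY)
  show ?thesis
  proof (rule graph_eqI)
    show "contraction (graph_union G H) r \<in> graphs (quot X (restr r X) \<union> quot Y (restr r Y))"
      using contraction_graphs[OF graph_union_graphs[OF assms(2,3)], of r] by (simp add: quot)
    show "graph_union (contraction G (restr r X)) (contraction H (restr r Y))
        \<in> graphs (quot X (restr r X) \<union> quot Y (restr r Y))"
      using assms(2,3) by (intro graph_union_graphs contraction_graphs)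
    show "adj (contraction (graph_union G H) r)
        = adj (graph_union (contraction G (restr r X)) (contraction H (restr r Y)))"
      by (simp add: adj_contraction adj_graph_union imX imY image_Un Un_Diff)
  qed
qed

text \<open>Related points are joined by a path in the disjoint union, and no edge leaves the side
  on which it starts.\<close>

lemma Ec_graph_union_imp_split:
  assumes "X \<inter> Y = {}" "G \<in> graphs X" "H \<in> graphs Y" "equiv (X \<union> Y) r"
    and "r \<in> Ec (graph_union G H)"
  shows "r = restr r X \<union> restr r Y"
proof -
  have adj: "adj G \<subseteq> X \<times> X" "adj H \<subseteq> Y \<times> Y"
    using adj_graphs[OF assms(2)] adj_graphs[OF assms(3)] by auto
  have "(x, y) \<in> restr r X \<union> restr r Y" if xy: "(x, y) \<in> r" for x y
  proof -
    have "(x, y) \<in> ((adj G \<union> adj H) \<inter> r)\<^sup>*"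
      using xy assms(5) Ec_iff[OF graph_union_graphs[OF assms(2,3)] assms(4)]
      by (auto simp: adj_graph_union)
    then have "(x \<in> X \<longrightarrow> y \<in> X) \<and> (x \<in> Y \<longrightarrow> y \<in> Y)"
    proof induction
      case (step y z)
      then show ?case using adj assms(1) by blast
    qed simp
    moreover have "x \<in> X \<union> Y"
      using xy assms(4) by (auto simp: equiv_def)
    ultimately show ?thesis
      using xy by (auto simp: restr_def)
  qed
  then show ?thesis
    by (auto simp: restr_def)
qed


section \<open>Edgeless quotients and extractions\<close>

text \<open>With no edge inside \<open>r\<close>, only trivial paths remain, so connected classes
  are singletons. Conversely, graphs have no loops.\<close>

lemma extraction_edgeless_iff:
  assumes "G \<in> graphs X" "equiv X r" "r \<in> Ec G"
  shows "extraction G r = (X, {}) \<longleftrightarrow> r = Id_on X"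
proof -
  have r: "r \<subseteq> X \<times> X" "\<And>x. x \<in> X \<Longrightarrow> (x, x) \<in> r"
    using assms(2) by (auto simp: equiv_def refl_on_def)
  have "r \<subseteq> (adj G \<inter> r)\<^sup>*"
    using assms Ec_iff by blast
  then have "adj G \<inter> r = {} \<longleftrightarrow> r = Id_on X"
    using r adj_graphs[OF assms(1)] by (auto simp: Id_on_def)
  then show ?thesis
    using edgeless_iff[OF extraction_graphs[OF assms(1)]] equiv_sym[OF assms(2)]
    by (simp add: adj_extraction)
qed

lemma Id_on_in_Ec: "G \<in> graphs X \<Longrightarrow> Id_on X \<in> Ec G"
  by (subst Ec_iff[of G X]) (auto simp: equiv_def refl_on_def sym_Id_on trans_Id_on)

text \<open>Contracting singletons merges nothing: it only renames each vertex to its class. This is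
  the identification used in the right counit law.\<close>

lemma contraction_Id_on:
  assumes "finite X" "G \<in> graphs X"
  shows "contraction G (Id_on X) = relabel (cl (Id_on X)) G"
proof (rule graph_eqI)
  have eq: "equiv X (Id_on X)"
    using EcD_equiv[OF Id_on_in_Ec[OF assms(2)]] by (simp add: fst_graphs[OF assms(2)])
  then have cl: "cl (Id_on X) x = cl (Id_on X) y \<longleftrightarrow> x = y" if "x \<in> X" "y \<in> X" for x y
    using cl_eq_iff[OF assms(1) eq that] that by auto
  then have "inj_on (cl (Id_on X)) X"
    by (auto simp: inj_on_def)
  from relabel_graphs[OF assms(2) this]
  show "relabel (cl (Id_on X)) G \<in> graphs (quot X (Id_on X))"
    by (simp add: quot_eq)
  show "contraction G (Id_on X) \<in> graphs (quot X (Id_on X))"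
    using assms(2) by (rule contraction_graphs)
  show "adj (contraction G (Id_on X)) = adj (relabel (cl (Id_on X)) G)"
    using adj_graphs[OF assms(2)] cl by (auto simp: adj_contraction adj_relabel[OF assms(2)])
qed

text \<open>The restriction to the vertex set is needed because the closure relates every element of
  the type to itself.\<close>

definition components :: "'v graph \<Rightarrow> ('v \<times> 'v) set" where
  "components G = (adj G)\<^sup>* \<inter> fst G \<times> fst G"

lemma equiv_components: "equiv (fst G) (components G)"
proof (rule equivI)
  have "sym ((adj G)\<^sup>*)"
    by (rule sym_rtrancl[OF sym_adj])
  then show "sym (components G)"
    by (auto simp: components_def sym_def)
  show "trans (components G)"
    by (auto simp: components_def trans_def intro: rtrancl_trans)
qed (auto simp: components_def refl_on_def)

lemma adj_subset_components: "G \<in> graphs X \<Longrightarrow> adj G \<subseteq> components G"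
  using adj_graphs[of G X] by (auto simp: components_def fst_graphs)

text \<open>An edgeless quotient means that all edges lie inside \<open>r\<close>, hence so do the
  components. Connected classes give the reverse inclusion.\<close>

lemma contraction_edgeless_iff:
  assumes "finite X" "G \<in> graphs X" "equiv X r"
  shows "r \<in> Ec G \<and> contraction G r = (quot X r, {}) \<longleftrightarrow> r = components G"
proof -
  have r: "r \<subseteq> X \<times> X" "\<And>x. x \<in> X \<Longrightarrow> (x, x) \<in> r" "trans r"
    using assms(3) by (auto simp: equiv_def refl_on_def)
  have fst: "fst G = X"
    by (rule fst_graphs[OF assms(2)])
  have "adj (contraction G r) = {} \<longleftrightarrow> adj G \<subseteq> r"
  proof -
    have "adj (contraction G r) = {} \<longleftrightarrow> (\<forall>(x, y)\<in>adj G. cl r x = cl r y)"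
      by (auto simp: adj_contraction image_subset_iff)
    also have "\<dots> \<longleftrightarrow> adj G \<subseteq> r"
      using adj_graphs[OF assms(2)] cl_eq_iff[OF assms(1,3)] by blast
    finally show ?thesis .
  qed
  then have edgeless: "contraction G r = (quot X r, {}) \<longleftrightarrow> adj G \<subseteq> r"
    using edgeless_iff[OF contraction_graphs[OF assms(2)]] by simp
  have "r \<subseteq> (adj G \<inter> r)\<^sup>* \<and> adj G \<subseteq> r \<longleftrightarrow> r = components G"
  proof
    assume *: "r \<subseteq> (adj G \<inter> r)\<^sup>* \<and> adj G \<subseteq> r"
    then have "adj G \<inter> r = adj G"
      by blast
    \<comment> \<open>By transitivity nontrivial paths stay in \<open>r\<close>; the reflexive
      closure accounts for trivial paths at points outside \<open>X\<close>.\<close>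
    moreover have "(adj G)\<^sup>* \<subseteq> r\<^sup>="
      using rtrancl_mono[of "adj G" r] * r(3) by (metis rtrancl_trancl_reflcl trancl_id)
    ultimately show "r = components G"
      using * r by (auto simp: components_def fst)
  next
    assume "r = components G"
    moreover have "adj G \<inter> components G = adj G"
      using adj_subset_components[OF assms(2)] by blast
    ultimately show "r \<subseteq> (adj G \<inter> r)\<^sup>* \<and> adj G \<subseteq> r"
      using adj_subset_components[OF assms(2)] by (auto simp: components_def)
  qed
  then show ?thesis
    using edgeless Ec_iff[OF assms(2,3)] by simp
qed

lemma extraction_components:
  assumes "G \<in> graphs X"
  shows "extraction G (components G) = G"
  using assms adj_subset_components[OF assms] equiv_sym[OF equiv_components[of G]]
  by (intro graph_eqI[of _ X]) (auto simp: extraction_graphs adj_extraction)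


section \<open>The contraction-extraction coproduct\<close>

lemma graph_delta_in_Ec:
  "r \<in> Ec G \<Longrightarrow> graph_delta r (bvec G) = bvec (contraction G r, extraction G r)"
  by (simp add: graph_delta_bvec)

lemma graph_delta_not_in_Ec: "r \<notin> Ec G \<Longrightarrow> graph_delta r (bvec G) = 0"
  by (simp add: graph_delta_bvec)

lemma species_graphs:
  "species graphs
     (graph_act :: 'a obj set \<Rightarrow> ('a obj \<Rightarrow> 'a obj) \<Rightarrow>
        ('a obj graph \<Rightarrow>\<^sub>0 'k::field) \<Rightarrow> ('a obj graph \<Rightarrow>\<^sub>0 'k))"
proof
  fix X Y :: "'a obj set" and \<sigma> :: "'a obj \<Rightarrow> 'a obj"
  assume "bij_betw \<sigma> X Y"
  then show "linear_map (graphs X) (graphs Y)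
      (graph_act X \<sigma> :: ('a obj graph \<Rightarrow>\<^sub>0 'k) \<Rightarrow> ('a obj graph \<Rightarrow>\<^sub>0 'k))"
    using relabel_graphs[of _ X \<sigma>]
    by (intro linear_mapI[OF linear_graph_act]) (auto simp: bij_betw_def)
next
  fix X Y :: "'a obj set" and \<sigma> \<tau> :: "'a obj \<Rightarrow> 'a obj" and v :: "'a obj graph \<Rightarrow>\<^sub>0 'k"
  assume "\<And>x. x \<in> X \<Longrightarrow> \<sigma> x = \<tau> x" and v: "v \<in> vspace (graphs X)"
  then have basis: "relabel \<sigma> G = relabel \<tau> G" if "G \<in> graphs X" for G
    using that by (intro relabel_cong)
  show "graph_act X \<sigma> v = graph_act X \<tau> v"
    by (rule linear_map_eqI[OF linear_graph_act linear_graph_act _ v]) (simp add: basis)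
next
  fix X :: "'a obj set" and v :: "'a obj graph \<Rightarrow>\<^sub>0 'k"
  assume v: "v \<in> vspace (graphs X)"
  show "graph_act X id v = v"
    by (rule linear_map_eqI[OF linear_graph_act linear_map_id _ v]) simp
next
  fix X Y Z :: "'a obj set" and \<sigma> \<tau> :: "'a obj \<Rightarrow> 'a obj" and v :: "'a obj graph \<Rightarrow>\<^sub>0 'k"
  assume v: "v \<in> vspace (graphs X)"
  show "graph_act X (\<tau> \<circ> \<sigma>) v = graph_act Y \<tau> (graph_act X \<sigma> v)"
    by (rule linear_map_eqI[OF _ _ _ v])
      (simp_all add: linear_map_UNIV linear_simps o_def flip: relabel_comp)
qed

lemma graph_counit_laws:
  fixes X :: "'a obj set" and v :: "'a obj graph \<Rightarrow>\<^sub>0 'k::field"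
  defines "\<epsilon> \<equiv> \<lambda>X (v :: 'a obj graph \<Rightarrow>\<^sub>0 'k). Poly_Mapping.lookup v (X, {})"
  assumes X: "finite X" and v: "v \<in> vspace (graphs X)"
  shows "bij_betw \<sigma> X Y \<Longrightarrow> \<epsilon> Y (graph_act X \<sigma> v) = \<epsilon> X v"
    and "equiv X r \<Longrightarrow>
      Id_\<otimes> (\<epsilon> X) (graph_delta r v) = (if r = Id_on X then graph_act X (cl r) v else 0)"
    and "(\<Sum>r | equiv X r. \<otimes>_Id (\<epsilon> (quot X r)) (graph_delta r v)) = v"
proof -
  assume \<sigma>: "bij_betw \<sigma> X Y"
  show "\<epsilon> Y (graph_act X \<sigma> v) = \<epsilon> X v"
    \<comment> \<open>The values are scalars, so the induction replaces
      \<open>linear_map_eqI\<close>.\<close>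
    using v
  proof (induction rule: vspace_induct)
    case (add c G u)
    have "relabel \<sigma> G = (Y, {}) \<longleftrightarrow> G = (X, {})"
      using add.hyps(1) \<sigma> by (cases G) (auto simp: relabel_def graphs_def bij_betw_def)
    with add.IH show ?case
      by (simp add: \<epsilon>_def linear_simps lookup_add lookup_bvec)
  qed (simp add: \<epsilon>_def)
next
  assume r: "equiv X r"
  have basis: "Id_\<otimes> (\<epsilon> X) (graph_delta r (bvec G)) = (if r = Id_on X then bvec (relabel (cl r) G) else 0)"
    if G: "G \<in> graphs X" for G
  proof (cases "r \<in> Ec G")
    case True
    then show ?thesis
      using extraction_edgeless_iff[OF G r True] contraction_Id_on[OF X G]
      by (simp add: graph_delta_in_Ec \<epsilon>_def lookup_bvec)
  next
    case False
    then show ?thesis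
      using Id_on_in_Ec[OF G] by (auto simp: graph_delta_not_in_Ec)
  qed
  show "Id_\<otimes> (\<epsilon> X) (graph_delta r v) = (if r = Id_on X then graph_act X (cl r) v else 0)"
    by (rule linear_map_eqI[OF _ _ _ v]) (simp_all add: linear_map_UNIV linear_simps basis)
next
  have basis: "(\<Sum>r | equiv X r. \<otimes>_Id (\<epsilon> (quot X r)) (graph_delta r (bvec G))) = bvec G"
    if G: "G \<in> graphs X" for G
  proof -
    \<comment> \<open>Exactly one relation contributes, that of the connected components, and
      extraction by it gives back \<open>G\<close>.\<close>
    have "\<otimes>_Id (\<epsilon> (quot X r)) (graph_delta r (bvec G)) = (if r = components G then bvec G else 0)"
      if "equiv X r" for r
      using contraction_edgeless_iff[OF X G that] extraction_components[OF G]
      by (cases "r \<in> Ec G") (auto simp: graph_delta_in_Ec graph_delta_not_in_Ec \<epsilon>_def lookup_bvec)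
    then have "(\<Sum>r | equiv X r. \<otimes>_Id (\<epsilon> (quot X r)) (graph_delta r (bvec G)))
        = (\<Sum>r | equiv X r. if r = components G then bvec G else 0)"
      by (intro sum.cong) auto
    \<comment> \<open>Over an infinite index set \<open>sum\<close> would be 0 by default.\<close>
    moreover have "finite {r. equiv X r}"
      by (rule finite_subset[of _ "Pow (X \<times> X)"]) (use X in \<open>auto simp: equiv_def\<close>)
    moreover have "equiv X (components G)"
      using equiv_components[of G] by (simp add: fst_graphs[OF G])
    ultimately show ?thesis
      by simp
  qed
  show "(\<Sum>r | equiv X r. \<otimes>_Id (\<epsilon> (quot X r)) (graph_delta r v)) = v"
    by (rule linear_map_eqI[OF _ linear_map_id basis v])
      (simp add: linear_map_UNIV linear_simps sum.distrib smul_sum)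
qed

lemma contraction_extraction_coproduct_graphs:
  "contraction_extraction_coproduct graphs graph_act
     (graph_delta :: ('a obj \<times> 'a obj) set \<Rightarrow>
        ('a obj graph \<Rightarrow>\<^sub>0 'k::field) \<Rightarrow> ('a obj graph \<times> 'a obj graph \<Rightarrow>\<^sub>0 'k))"
proof -
  interpret species graphs
    "graph_act :: 'a obj set \<Rightarrow> ('a obj \<Rightarrow> 'a obj) \<Rightarrow>
       ('a obj graph \<Rightarrow>\<^sub>0 'k) \<Rightarrow> ('a obj graph \<Rightarrow>\<^sub>0 'k)"
    by (rule species_graphs)
  show ?thesis
  proof
    fix X :: "'a obj set" and r
    show "linear_map (graphs X) (graphs (quot X r) \<times> graphs X)
        (graph_delta r :: ('a obj graph \<Rightarrow>\<^sub>0 'k) \<Rightarrow> ('a obj graph \<times> 'a obj graph \<Rightarrow>\<^sub>0 'k))"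
      by (rule linear_mapI[OF linear_graph_delta])
        (simp add: graph_delta_bvec contraction_graphs extraction_graphs)
  next
    fix X Y :: "'a obj set" and r \<sigma> and v :: "'a obj graph \<Rightarrow>\<^sub>0 'k"
    assume X: "finite X" and r: "equiv X r" and \<sigma>: "bij_betw \<sigma> X Y"
      and v: "v \<in> vspace (graphs X)"
    show "graph_delta (transport \<sigma> r) (graph_act X \<sigma> v)
        = (graph_act (quot X r) (quot_map \<sigma>) \<otimes>\<^sub>m graph_act X \<sigma>) (graph_delta r v)"
    proof (rule linear_map_eqI[OF _ _ _ v])
      fix G :: "'a obj graph" assume G: "G \<in> graphs X"
      show "graph_delta (transport \<sigma> r) (graph_act X \<sigma> (bvec G :: 'a obj graph \<Rightarrow>\<^sub>0 'k))
          = (graph_act (quot X r) (quot_map \<sigma>) \<otimes>\<^sub>m graph_act X \<sigma>) (graph_delta r (bvec G))"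
        using Ec_relabel_iff[OF G \<sigma> r] contraction_relabel[OF X G \<sigma> r] extraction_relabel[OF G \<sigma> r]
        by (simp add: graph_delta_bvec)
    qed (simp_all add: linear_map_UNIV linear_simps)
  next
    fix X :: "'a obj set" and r r' and v :: "'a obj graph \<Rightarrow>\<^sub>0 'k"
    assume X: "finite X" and r: "equiv X r" and r': "equiv X r'" and le: "eq_le r r'"
      and v: "v \<in> vspace (graphs X)"
    let ?q = "quot_rel r r'"
    let ?f = "\<lambda>u :: 'a obj graph \<Rightarrow>\<^sub>0 'k.
      (graph_act (quot (quot X r') ?q) flat \<otimes>\<^sub>m id) (graph_delta ?q u)"
    have sub: "r' \<subseteq> r"
      using le by (auto simp: eq_le_def)
    show "assoc ((?f \<otimes>\<^sub>m id) (graph_delta r' v)) = (id \<otimes>\<^sub>m graph_delta r') (graph_delta r v)"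
    proof (rule linear_map_eqI[OF _ _ _ v])
      fix G :: "'a obj graph" assume G: "G \<in> graphs X"
      note ext = Ec_extraction_iff[OF G r r' sub]
      show "assoc ((?f \<otimes>\<^sub>m id) (graph_delta r' (bvec G)))
          = (id \<otimes>\<^sub>m graph_delta r') (graph_delta r (bvec G))"
      proof (cases "r' \<in> Ec G")
        case True
        \<comment> \<open>Both sides are nonzero exactly when \<open>r\<close> is in
          \<open>Ec G\<close>. The three graph identities then match the three tensor factors one by
          one.\<close>
        show ?thesis
          using True Ec_contraction_iff[OF X G r True sub] ext
            relabel_flat_contraction[OF X G r r' sub] extraction_contraction[OF X G r r' sub]
            extraction_extraction[OF G r r' sub]
          by (simp add: graph_delta_bvec assoc_def)
      next
        case False
        \<comment> \<open>The left side vanishes at \<open>graph_delta r'\<close>. On the right,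
          \<open>r'\<close> cannot have connected classes in the extraction by \<open>r\<close>
          either.\<close>
        then show ?thesis
          using ext by (simp add: graph_delta_bvec assoc_def)
      qed
    qed (simp_all add: assoc_def linear_map_UNIV linear_simps)
  next
    fix X :: "'a obj set" and r r' and v :: "'a obj graph \<Rightarrow>\<^sub>0 'k"
    assume r: "equiv X r" and r': "equiv X r'" and le: "\<not> eq_le r r'"
      and v: "v \<in> vspace (graphs X)"
    show "(id \<otimes>\<^sub>m graph_delta r') (graph_delta r v) = 0"
    proof (rule linear_map_eqI[OF _ _ _ v])
      fix G :: "'a obj graph" assume G: "G \<in> graphs X"
      have "r' \<notin> Ec (extraction G r)"
        using Ec_extraction_imp_subset[OF G r r'] le by (auto simp: eq_le_def)
      then show "(id \<otimes>\<^sub>m graph_delta r') (graph_delta r (bvec G :: 'a obj graph \<Rightarrow>\<^sub>0 'k)) = 0"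
        by (simp add: graph_delta_bvec)
    qed (simp_all add: linear_map_UNIV linear_simps)
  next
    show "\<exists>\<epsilon> :: 'a obj set \<Rightarrow> ('a obj graph \<Rightarrow>\<^sub>0 'k) \<Rightarrow> 'k.
         (\<forall>X. finite X \<longrightarrow> linear_form (graphs X) (\<epsilon> X)) \<and>
         (\<forall>X Y \<sigma>. finite X \<longrightarrow> bij_betw \<sigma> X Y \<longrightarrow>
            (\<forall>v\<in>vspace (graphs X). \<epsilon> Y (graph_act X \<sigma> v) = \<epsilon> X v)) \<and>
         (\<forall>X r. finite X \<longrightarrow> equiv X r \<longrightarrow>
            (\<forall>v\<in>vspace (graphs X). Id_\<otimes> (\<epsilon> X) (graph_delta r v) =
               (if r = Id_on X then graph_act X (cl r) v else 0))) \<and>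
         (\<forall>X. finite X \<longrightarrow>
            (\<forall>v\<in>vspace (graphs X). (\<Sum>r | equiv X r. \<otimes>_Id (\<epsilon> (quot X r)) (graph_delta r v)) = v))"
      \<comment> \<open>Unlike \<open>graph_counit\<close>, the counit of the coproduct
        \<open>graph_Delta\<close>, this form takes the value 1 on every edgeless graph.\<close>
      by (rule exI[of _ "\<lambda>X v. Poly_Mapping.lookup v (X, {})"])
        (simp add: linear_form_def lookup_add graph_counit_laws)
  qed
qed


section \<open>Compatibility with the product and the coproduct\<close>

lemma Ec_empty: "{} \<in> Ec empty_graph"
  by (simp add: Ec_def empty_graph_def equiv_def refl_on_def)

lemma graph_delta_empty: "graph_delta {} (bvec empty_graph) = bvec (empty_graph, empty_graph)"
  by (simp add: graph_delta_in_Ec[OF Ec_empty])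
    (simp add: contraction_def extraction_def empty_graph_def quot_def)

lemma compatible_product_graphs:
  "compatible_product graphs graph_m (graph_one :: 'a obj graph \<Rightarrow>\<^sub>0 'k::field) graph_delta"
  unfolding compatible_product_def
proof (intro conjI allI impI ballI)
  show "graph_delta {} (graph_one :: 'a obj graph \<Rightarrow>\<^sub>0 'k) = graph_one \<otimes> graph_one"
    by (simp add: graph_one_def graph_delta_empty)
next
  fix X Y :: "'a obj set" and r and t :: "'a obj graph \<times> 'a obj graph \<Rightarrow>\<^sub>0 'k"
  assume fin: "finite X" "finite Y" and disj: "X \<inter> Y = {}" and r: "equiv (X \<union> Y) r"
    and t: "t \<in> vspace (graphs X \<times> graphs Y)"
  let ?P = "\<lambda>t :: 'a obj graph \<times> 'a obj graph \<Rightarrow>\<^sub>0 'k.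
    (graph_m (quot X (restr r X)) (quot Y (restr r Y)) \<otimes>\<^sub>m graph_m X Y)
      (middle_flip ((graph_delta (restr r X) \<otimes>\<^sub>m graph_delta (restr r Y)) t))"
  have basis: "graph_delta r (graph_m X Y (bvec (G, H))) =
      (if r = restr r X \<union> restr r Y then ?P (bvec (G, H)) else 0)"
    if G: "G \<in> graphs X" and H: "H \<in> graphs Y" for G H
  proof (cases "r = restr r X \<union> restr r Y")
    case split: True
    have GH: "graph_union G H \<in> graphs (X \<union> Y)"
      using G H by (rule graph_union_graphs)
    \<comment> \<open>Rewrites the induced subgraphs in \<open>Ec_induced_iff\<close> and
      \<open>extraction_split\<close> to \<open>G\<close> and \<open>H\<close>.\<close>
    note ind = induced_graph_union[OF disj G H]
    have "graph_delta r (bvec (graph_union G H)) = ?P (bvec (G, H))"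
      using Ec_induced_iff[OF disj GH r split] contraction_graph_union[OF disj G H split]
        extraction_split[OF GH r split]
      by (simp add: ind graph_delta_bvec middle_flip_def)
    with split show ?thesis by simp
  next
    case False
    then have "r \<notin> Ec (graph_union G H)"
      using Ec_graph_union_imp_split[OF disj G H r] by blast
    with False show ?thesis
      by (simp add: graph_delta_not_in_Ec)
  qed
  show "graph_delta r (graph_m X Y t) = (if r = restr r X \<union> restr r Y then ?P t else 0)"
  proof (rule linear_map_eqI[OF _ _ _ t])
    fix b assume "b \<in> graphs X \<times> graphs Y"
    then obtain G H where "b = (G, H)" "G \<in> graphs X" "H \<in> graphs Y"
      by auto
    then show "graph_delta r (graph_m X Y (bvec b)) =
        (if r = restr r X \<union> restr r Y then ?P (bvec b) else 0)"
      by (simp only: basis)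
  qed (simp_all add: middle_flip_def linear_map_UNIV linear_simps)
qed

lemma compatible_coproduct_graphs:
  "compatible_coproduct graphs graph_m (graph_one :: 'a obj graph \<Rightarrow>\<^sub>0 'k::field)
     graph_Delta graph_counit graph_delta"
  unfolding compatible_coproduct_def
proof (intro conjI allI impI ballI)
  fix X Y :: "'a obj set" and r and v :: "'a obj graph \<Rightarrow>\<^sub>0 'k"
  assume fin: "finite X" "finite Y" and disj: "X \<inter> Y = {}" and r: "equiv (X \<union> Y) r"
    and split: "r = restr r X \<union> restr r Y" and v: "v \<in> vspace (graphs (X \<union> Y))"
  let ?Q = "graph_Delta (quot X (restr r X)) (quot Y (restr r Y)) \<otimes>\<^sub>m id"
  show "?Q (graph_delta r v) = m_1_3_24 (graph_m X Y)
      ((graph_delta (restr r X) \<otimes>\<^sub>m graph_delta (restr r Y)) (graph_Delta X Y v))"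
  proof (rule linear_map_eqI[OF _ _ _ v])
    fix G :: "'a obj graph" assume G: "G \<in> graphs (X \<union> Y)"
    \<comment> \<open>\<open>induced_contraction\<close> treats the first of two disjoint sets;
      exchanging them gives the second tensor factor.\<close>
    have swap: "Y \<inter> X = {}" "G \<in> graphs (Y \<union> X)" "equiv (Y \<union> X) r" "r = restr r Y \<union> restr r X"
      using disj G r split by (simp_all add: Un_commute Int_commute)
    show "?Q (graph_delta r (bvec G)) = m_1_3_24 (graph_m X Y)
        ((graph_delta (restr r X) \<otimes>\<^sub>m graph_delta (restr r Y)) (graph_Delta X Y (bvec G)))"
      using Ec_induced_iff[OF disj G r split] induced_contraction[OF fin disj G r split]
        induced_contraction[OF fin(2,1) swap] extraction_split[OF G r split]
      by (simp add: graph_delta_bvec m_1_3_24_def middle_flip_def)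
  qed (simp_all add: m_1_3_24_def middle_flip_def linear_map_UNIV linear_simps)
next
  fix v :: "'a obj graph \<Rightarrow>\<^sub>0 'k"
  assume "v \<in> vspace (graphs {})"
  then show "\<otimes>_Id graph_counit (graph_delta {} v) = smul (graph_counit v) graph_one"
  \<comment> \<open>The space on the empty set is spanned by \<open>empty_graph\<close>, so one
    basis vector has to be checked.\<close>
  proof (induction rule: vspace_induct)
    case (add c G u)
    then show ?case
      by (simp add: graphs_empty linear_simps graph_delta_empty
          graph_counit_def graph_one_def lookup_add lookup_bvec smul_add_left)
  qed (simp add: graph_counit_def)
qed

theorem proposition2p7:
  "contraction_extraction_coproduct graphs graph_act
     (graph_delta :: ('a obj \<times> 'a obj) set \<Rightarrow>
        ('a obj graph \<Rightarrow>\<^sub>0 'k::field) \<Rightarrow> ('a obj graph \<times> 'a obj graph \<Rightarrow>\<^sub>0 'k)) \<and>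
   compatible_product graphs graph_m (graph_one :: 'a obj graph \<Rightarrow>\<^sub>0 'k) graph_delta \<and>
   compatible_coproduct graphs graph_m (graph_one :: 'a obj graph \<Rightarrow>\<^sub>0 'k)
     graph_Delta graph_counit graph_delta"
  by (intro conjI contraction_extraction_coproduct_graphs compatible_product_graphs
      compatible_coproduct_graphs)

end
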